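(* For each integer $d\ge3$ there exists a positive integer $\tau_d\ge2$ such that $T_{2d}^{(k)}=T_{2d}^{(\tau_d)}$ for all $k\ge\tau_d$, $T_{2d}^{(\tau_d-1)}\supsetneq T_{2d}^{(\tau_d)}$, and $\operatorname{trop}(\mathcal{B}\mathcal{P}_{2d}^* )=T_{2d}^{(\tau_d)}$.
   Context: Let $\Lambda_{2d}^{\varepsilon}$ be the set of partitions of $2d$ all of whose parts are even; its cardinality is $\pi(d)$, the number of partitions of $d$, and coordinates of $\mathbb{R}^{\pi(d)}$ are indexed by $\Lambda_{2d}^\varepsilon$. For a partition $\lambda$ with $\ell(\lambda)$ parts write $\lambda_{(1)}\le\cdots\le\lambda_{(\ell(\lambda))}$ for its parts in increasing order. Superdominance order: for partitions $\lambda,\mu$ of the same integer, $\lambda\succeq\mu$ means $\sum_{i=1}^{j}\lambda_{(i)}\le\sum_{i=1}^{j}\mu_{(i)}$ for each $j=1,\dots,\min\{\ell(\lambda),\ell(\mu)\}$. The fusion $\lambda^1\cdots\lambda^k$ of partitions is the partition whose parts are the parts of all the $\lambda^i$ put together (with multiplicity); $\mu^{\circ k}$ is the fusion of $k$ copies of $\mu$. For $k\ge1$, $T_{2d}^{(k)}\subset\mathbb{R}^{\pi(d)}$ is the set of $y$ satisfying $y_{\lambda^1}+\cdots+y_{\lambda^k}\ge k\,y_\mu$ for all $\lambda^1,\dots,\lambda^k,\mu\in\Lambda_{2d}^\varepsilon$ with $\lambda^1\cdots\lambda^k\succeq\mu^{\circ k}$. For a partition $\lambda$, $p_\lambda=\prod_i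 p_{\lambda_i}$ with $p_r=X_1^r+\cdots+X_n^r$. $\mathcal{B}\mathcal{P}_{2d}$ is the set of $c\in\mathbb{R}^{\Lambda_{2d}^\varepsilon}$ such that for every $n\ge2d$ the form $\sum_\lambda c_\lambda p_\lambda(X_1,\dots,X_n)$ is nonnegative on $\mathbb{R}^n$. Its dual cone is $\mathcal{B}\mathcal{P}_{2d}^*=\{\varphi\in\mathbb{R}^{\Lambda_{2d}^\varepsilon}:\sum_\lambda c_\lambda\varphi_\lambda\ge0\ \text{for all } c\in\mathcal{B}\mathcal{P}_{2d}\}$, which lies in the nonnegative orthant. For $S\subset\mathbb{R}_{\ge0}^s$, $\operatorname{trop}(S)=\lim_{t\to\infty}\log_t(S\cap\mathbb{R}_{>0}^s)$ with $\log_t$ applied coordinatewise; equivalently $y\in\operatorname{trop}(S)$ iff there are sequences $x^{(m)}\in S\cap\mathbb{R}_{>0}^s$ and $\tau_m\in(0,1)$ with $\tau_m\to0$ and $y=\lim_{m\to\infty}\log_{1/\tau_m}(x^{(m)})$. *)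

theory Defs
  imports Complex_Main "HOL-Library.Multiset" "HOL-Library.FuncSet"
begin

text \<open>
  A partition of \<open>m\<close> is a multiset of positive natural numbers with sum \<open>m\<close>.
  For a finite index set \<open>I\<close>, the space of real vectors with coordinates indexed by \<open>I\<close> is
  \<open>I \<rightarrow>\<^sub>E UNIV\<close>: being \<open>undefined\<close> outside \<open>I\<close>, such a function is determined by its
  coordinates, so that equality and inclusion of sets of vectors have their usual meaning.
\<close>

definition partitions :: "nat \<Rightarrow> nat multiset set" where
  "partitions m = {\<alpha>. (\<forall>r\<in>#\<alpha>. 0 < r) \<and> sum_mset \<alpha> = m}"

definition even_partitions :: "nat \<Rightarrow> nat multiset set" where
  "even_partitions d = {\<alpha> \<in> partitions (2 * d). \<forall>r\<in>#\<alpha>. even r}"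

lemma finite_partitions: "finite (partitions m)"
proof (rule finite_subset)
  show "partitions m \<subseteq> mset ` {xs. set xs \<subseteq> {..m} \<and> length xs \<le> m}"
  proof
    fix \<alpha> assume l: "\<alpha> \<in> partitions m"
    obtain xs where xs: "mset xs = \<alpha>" using ex_mset by blast
    have "sum_list xs = m" "\<forall>r\<in>set xs. 1 \<le> r"
      using l xs by (auto simp: partitions_def Suc_le_eq simp flip: sum_mset_sum_list)
    moreover have "length xs \<le> sum_list xs" if "\<forall>r\<in>set xs. 1 \<le> r" for xs :: "nat list"
      using that by (induction xs) auto
    ultimately have "set xs \<subseteq> {..m} \<and> length xs \<le> m"
      using member_le_sum_list by fastforce
    then show "\<alpha> \<in> mset ` {xs. set xs \<subseteq> {..m} \<and> length xs \<le> m}" using xs by blast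
  qed
  show "finite (mset ` {xs. set xs \<subseteq> {..m} \<and> length xs \<le> m})"
    by (intro finite_imageI finite_lists_length_le) simp
qed

lemma finite_even_partitions: "finite (even_partitions d)"
  by (rule finite_subset[OF _ finite_partitions[of "2 * d"]]) (auto simp: even_partitions_def)

text \<open>
  Superdominance is only meant for partitions of the same integer; \<open>sorted_list_of_multiset\<close>
  lists the parts in increasing order.
\<close>

definition superdominates :: "nat multiset \<Rightarrow> nat multiset \<Rightarrow> bool"  (infix "\<succeq>" 50) where
  "\<alpha> \<succeq> \<mu> \<longleftrightarrow> (\<forall>j\<in>{1..min (size \<alpha>) (size \<mu>)}.
      sum_list (take j (sorted_list_of_multiset \<alpha>))
        \<le> sum_list (take j (sorted_list_of_multiset \<mu>)))"

text \<open>Fusion of partitions is the sum of multisets.\<close>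

definition fusion :: "nat \<Rightarrow> (nat \<Rightarrow> nat multiset) \<Rightarrow> nat multiset" where
  "fusion k \<Lambda> = (\<Sum>i\<in>{1..k}. \<Lambda> i)"

definition T :: "nat \<Rightarrow> nat \<Rightarrow> (nat multiset \<Rightarrow> real) set" where
  "T d k = {y \<in> even_partitions d \<rightarrow>\<^sub>E UNIV.
     \<forall>\<Lambda> \<mu>. (\<forall>i\<in>{1..k}. \<Lambda> i \<in> even_partitions d) \<longrightarrow> \<mu> \<in> even_partitions d \<longrightarrow>
       fusion k \<Lambda> \<succeq> fusion k (\<lambda>_. \<mu>) \<longrightarrow> (\<Sum>i\<in>{1..k}. y (\<Lambda> i)) \<ge> real k * y \<mu>}"

definition power_sum :: "nat \<Rightarrow> nat \<Rightarrow> (nat \<Rightarrow> real) \<Rightarrow> real" where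
  "power_sum n r X = (\<Sum>i\<in>{1..n}. X i ^ r)"

definition power_sum_partition :: "nat \<Rightarrow> nat multiset \<Rightarrow> (nat \<Rightarrow> real) \<Rightarrow> real" where
  "power_sum_partition n \<alpha> X = (\<Prod>r\<in>#\<alpha>. power_sum n r X)"

text \<open>
  The points of \<open>n\<close>-space are given by functions \<open>X :: nat \<Rightarrow> real\<close>, of which only the values
  at \<open>1, \<dots>, n\<close> matter.
\<close>

definition BP :: "nat \<Rightarrow> (nat multiset \<Rightarrow> real) set" where
  "BP d = {c \<in> even_partitions d \<rightarrow>\<^sub>E UNIV. \<forall>n\<ge>2 * d. \<forall>X.
     0 \<le> (\<Sum>\<alpha>\<in>even_partitions d. c \<alpha> * power_sum_partition n \<alpha> X)}"

definition BP_dual :: "nat \<Rightarrow> (nat multiset \<Rightarrow> real) set" where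
  "BP_dual d = {\<phi> \<in> even_partitions d \<rightarrow>\<^sub>E UNIV. \<forall>c\<in>BP d.
     0 \<le> (\<Sum>\<alpha>\<in>even_partitions d. c \<alpha> * \<phi> \<alpha>)}"

text \<open>
  The tropicalization of \<open>S\<close> is the limit of \<open>log\<^sub>t (S \<inter> (I \<rightarrow>\<^sub>E {0<..}))\<close> as \<open>t\<close> tends to
  infinity, described by sequences of points of \<open>S\<close> and of bases \<open>t = 1 / \<tau> m\<close>.
\<close>

definition trop :: "'i set \<Rightarrow> ('i \<Rightarrow> real) set \<Rightarrow> ('i \<Rightarrow> real) set" where
  "trop I S = {y \<in> I \<rightarrow>\<^sub>E UNIV.
     \<exists>(x :: nat \<Rightarrow> 'i \<Rightarrow> real) (\<tau> :: nat \<Rightarrow> real).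
       (\<forall>m. x m \<in> S \<inter> (I \<rightarrow>\<^sub>E {0<..})) \<and> (\<forall>m. \<tau> m \<in> {0<..<1}) \<and> \<tau> \<longlonglongrightarrow> 0 \<and>
       (\<forall>i\<in>I. (\<lambda>m. log (1 / \<tau> m) (x m i)) \<longlonglongrightarrow> y i)}"

end

theory Submission
  imports Defs "HOL-Analysis.Convex"
begin

text \<open>
  For partitions of the same integer, superdominance \<open>\<alpha> \<succeq> \<beta>\<close> means that every hinge sum
  \<open>\<Sum>r\<in>\<alpha>. max 0 (s - r)\<close> is at least that of \<open>\<beta>\<close>. By log-convexity and norm monotonicity, \<open>ln p\<^sub>r\<close> is for
  even \<open>r \<le> 2d\<close> a linear term plus a nonnegative combination of hinges, so superdominance gives
  inequalities between products of power sums; weighted AM-GM moves them to the dual cone, whence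
  the tropicalization lies in every \<open>T d k\<close> with \<open>k \<ge> 1\<close>.
  Conversely, every nonnegative combination of hinges is the growth exponent of the power sums of
  explicit lists, and sums of the resulting points stay in the dual cone. Hence \<open>z\<close> is in the
  tropicalization as soon as for each \<open>\<mu>\<close> some nonnegative combination \<open>e\<close> of hinge sums satisfies
  \<open>e \<alpha> - e \<mu> \<le> z \<alpha> - z \<mu>\<close> for all \<open>\<alpha>\<close>. Fourier-Motzkin elimination turns solvability of this
  system into finitely many inequalities with integral weights, each one implied by \<open>z \<in> T d k\<close> for some \<open>k\<close>.
  Since \<open>T d k\<close> decreases in \<open>k\<close>, it is eventually equal to the tropicalization, and
  \<open>T d 1 \<noteq> T d 2\<close> follows from \<open>(2\<^sup>d)\<close>, \<open>(2\<^sup>d\<^sup>-\<^sup>3, 6)\<close> against twice \<open>(2\<^sup>d\<^sup>-\<^sup>2, 4)\<close>.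
\<close>

section \<open>Hinge sums and superdominance\<close>

text \<open>Subtraction on \<open>nat\<close> truncates at 0, which supplies the maximum in the
  hinge. For fixed \<open>s\<close> the value is additive in the multiset, so fusion becomes
  addition.\<close>

definition hinge :: "nat \<Rightarrow> nat multiset \<Rightarrow> nat" where
  "hinge s \<alpha> = (\<Sum>r\<in>#\<alpha>. s - r)"

lemma hinge_add [simp]: "hinge s (\<alpha> + \<beta>) = hinge s \<alpha> + hinge s \<beta>"
  by (simp add: hinge_def)

lemma hinge_add_mset [simp]: "hinge s (add_mset r \<alpha>) = (s - r) + hinge s \<alpha>"
  by (simp add: hinge_def)

lemma hinge_empty [simp]: "hinge s {#} = 0"
  by (simp add: hinge_def)

lemma hinge_sum: "hinge s (\<Sum>i\<in>A. \<Lambda> i) = (\<Sum>i\<in>A. hinge s (\<Lambda> i))"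
  by (induction A rule: infinite_finite_induct) auto

lemma hinge_mset: "hinge s (mset xs) = (\<Sum>x\<leftarrow>xs. s - x)"
  by (simp add: hinge_def flip: sum_mset_sum_list)

lemma mult_le_sum_list_add_hinge:
  "length xs * s \<le> sum_list xs + (\<Sum>x\<leftarrow>xs. s - x)" for xs :: "nat list"
  by (induction xs) auto

text \<open>Each kept part satisfies \<open>s \<le> x + (s - x)\<close>, and the dropped parts have
  nonnegative hinges. Together with \<open>take_eq_hinge\<close> this is a Legendre duality: for a
  sorted list, \<open>hinge s\<close> is the maximum over \<open>j\<close> of \<open>j * s\<close>
  minus the \<open>j\<close>-th partial sum.\<close>

lemma take_le_hinge:
  fixes xs :: "nat list"
  assumes "j \<le> length xs"
  shows "j * s \<le> sum_list (take j xs) + hinge s (mset xs)"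
proof -
  have "hinge s (mset xs) = (\<Sum>x\<leftarrow>take j xs. s - x) + (\<Sum>x\<leftarrow>drop j xs. s - x)"
    unfolding hinge_mset by (metis append_take_drop_id map_append sum_list_append)
  then show ?thesis
    using mult_le_sum_list_add_hinge[of "take j xs" s] assms by auto
qed

lemma take_eq_hinge:
  fixes xs :: "nat list"
  assumes "j \<le> length xs" "\<forall>x\<in>set (take j xs). x \<le> s" "\<forall>x\<in>set (drop j xs). s \<le> x"
  shows "j * s = sum_list (take j xs) + hinge s (mset xs)"
proof -
  have a: "length ys * s = sum_list ys + (\<Sum>x\<leftarrow>ys. s - x)" if "\<forall>x\<in>set ys. x \<le> s" for ys :: "nat list"
    using that by (induction ys) auto
  have b: "(\<Sum>x\<leftarrow>ys. s - x) = 0" if "\<forall>x\<in>set ys. s \<le> x" for ys :: "nat list"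
    using that by (induction ys) auto
  have "hinge s (mset xs) = (\<Sum>x\<leftarrow>take j xs. s - x) + (\<Sum>x\<leftarrow>drop j xs. s - x)"
    unfolding hinge_mset by (metis append_take_drop_id map_append sum_list_append)
  then show ?thesis
    using a[OF assms(2)] b[OF assms(3)] assms(1) by auto
qed

text \<open>The \<open>j\<close>-th partial sums are compared at a threshold where the duality bound
  is an equality for \<alpha>; for \<beta> it remains an inequality in the useful direction.\<close>

lemma superdominates_if_hinge_le:
  assumes "\<And>s. s \<in># \<alpha> \<Longrightarrow> hinge s \<beta> \<le> hinge s \<alpha>"
  shows "\<alpha> \<succeq> \<beta>"
  unfolding superdominates_def
proof
  fix j assume j: "j \<in> {1..min (size \<alpha>) (size \<beta>)}"
  define xs where "xs = sorted_list_of_multiset \<alpha>"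
  define ys where "ys = sorted_list_of_multiset \<beta>"
  have xs: "mset xs = \<alpha>" "sorted xs" "length xs = size \<alpha>"
    by (simp_all add: xs_def flip: size_mset)
  have ys: "mset ys = \<beta>" "length ys = size \<beta>"
    by (simp_all add: ys_def flip: size_mset)
  \<comment> \<open>The \<open>j\<close>-th smallest part: cutting after position \<open>j\<close>
    separates parts at most \<open>s\<close> from parts at least \<open>s\<close>, even when
    \<open>s\<close> is repeated.\<close>
  define s where "s = xs ! (j - 1)"
  have lt: "j - 1 < length xs" using j xs by auto
  have "s \<in># \<alpha>" using lt xs unfolding s_def by (metis nth_mem set_mset_mset)
  moreover have "j * s = sum_list (take j xs) + hinge s (mset xs)"
  proof (rule take_eq_hinge)
    show "j \<le> length xs" using lt by auto
    show "\<forall>x\<in>set (take j xs). x \<le> s"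
    proof
      fix x assume "x \<in> set (take j xs)"
      then obtain i where "i < j" "i < length xs" "x = xs ! i" by (auto simp: in_set_conv_nth)
      then show "x \<le> s" unfolding s_def using lt xs(2) by (auto intro: sorted_nth_mono)
    qed
    show "\<forall>x\<in>set (drop j xs). s \<le> x"
    proof
      fix x assume "x \<in> set (drop j xs)"
      then obtain i where "i < length xs - j" "x = xs ! (j + i)" by (auto simp: in_set_conv_nth)
      then show "s \<le> x" unfolding s_def using lt xs(2) by (auto intro: sorted_nth_mono)
    qed
  qed
  moreover have "j * s \<le> sum_list (take j ys) + hinge s (mset ys)"
    by (rule take_le_hinge) (use j ys in auto)
  ultimately show "sum_list (take j xs) \<le> sum_list (take j ys)"
    using assms xs(1) ys(1) by fastforce
qed

text \<open>Superdominance only compares partial sums up to the smaller length. If \<alpha> were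
  shorter, its full sum would be at most a partial sum of \<beta> that omits positive parts,
  contradicting the equal totals.\<close>

lemma superdominates_size:
  assumes "\<alpha> \<succeq> \<beta>" "sum_mset \<alpha> = sum_mset \<beta>" "\<And>r. r \<in># \<beta> \<Longrightarrow> 0 < r"
  shows "size \<beta> \<le> size \<alpha>"
proof (rule ccontr)
  assume "\<not> size \<beta> \<le> size \<alpha>"
  then have lt: "size \<alpha> < size \<beta>" by simp
  define xs where "xs = sorted_list_of_multiset \<alpha>"
  define ys where "ys = sorted_list_of_multiset \<beta>"
  have xs: "mset xs = \<alpha>" "length xs = size \<alpha>"
    by (simp_all add: xs_def flip: size_mset)
  have ys: "mset ys = \<beta>" "length ys = size \<beta>"
    by (simp_all add: ys_def flip: size_mset)
  have "drop (size \<alpha>) ys \<noteq> []" using lt ys by simp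
  then obtain y where y: "y \<in> set (drop (size \<alpha>) ys)" by (meson list.set_sel(1))
  then have "y \<in># \<beta>" using ys by (metis in_set_dropD set_mset_mset)
  then have "0 < sum_list (drop (size \<alpha>) ys)"
    using assms(3)[of y] member_le_sum_list[OF y] by linarith
  moreover have "sum_list ys = sum_list (take (size \<alpha>) ys) + sum_list (drop (size \<alpha>) ys)"
    by (metis append_take_drop_id sum_list_append)
  moreover have "sum_list (take (size \<alpha>) xs) \<le> sum_list (take (size \<alpha>) ys)"
  proof (cases "size \<alpha> = 0")
    case False
    then show ?thesis
      using assms(1) lt unfolding superdominates_def xs_def ys_def by (auto simp: Suc_le_eq)
  qed simp
  moreover have "sum_list xs = sum_list ys"
    using assms(2) xs ys by (metis sum_mset_sum_list)
  moreover have "sum_list (take (size \<alpha>) xs) = sum_list xs" using xs by simp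
  ultimately show False by linarith
qed

lemma superdominates_hinge_le:
  assumes "\<alpha> \<succeq> \<beta>" "sum_mset \<alpha> = sum_mset \<beta>" "\<And>r. r \<in># \<beta> \<Longrightarrow> 0 < r"
  shows "hinge s \<beta> \<le> hinge s \<alpha>"
proof -
  define xs where "xs = sorted_list_of_multiset \<alpha>"
  define ys where "ys = sorted_list_of_multiset \<beta>"
  have xs: "mset xs = \<alpha>" "length xs = size \<alpha>"
    by (simp_all add: xs_def flip: size_mset)
  have ys: "mset ys = \<beta>" "sorted ys" "length ys = size \<beta>"
    by (simp_all add: ys_def flip: size_mset)
  \<comment> \<open>Now the cut is chosen so that the bound is exact for \<beta>;
    \<open>superdominates_size\<close> ensures that \<alpha> has at least \<open>j\<close>
    parts.\<close>
  define j where "j = length (takeWhile (\<lambda>y. y < s) ys)"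
  have jl: "j \<le> size \<beta>" unfolding j_def ys(3)[symmetric] by (rule length_takeWhile_le)
  have tk: "take j ys = takeWhile (\<lambda>y. y < s) ys" "drop j ys = dropWhile (\<lambda>y. y < s) ys"
    unfolding j_def by (simp_all add: takeWhile_eq_take[symmetric] dropWhile_eq_drop[symmetric])
  have "j * s = sum_list (take j ys) + hinge s (mset ys)"
  proof (rule take_eq_hinge)
    show "j \<le> length ys" using jl ys by simp
    show "\<forall>x\<in>set (take j ys). x \<le> s"
      unfolding tk by (auto dest: set_takeWhileD)
    show "\<forall>x\<in>set (drop j ys). s \<le> x"
    proof
      fix x assume x: "x \<in> set (drop j ys)"
      then have ne: "dropWhile (\<lambda>y. y < s) ys \<noteq> []" by (metis empty_iff empty_set tk(2))
      have "sorted (dropWhile (\<lambda>y. y < s) ys)" using ys by (simp add: sorted_dropWhile)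
      moreover have "s \<le> hd (dropWhile (\<lambda>y. y < s) ys)" using hd_dropWhile[OF ne] by simp
      ultimately show "s \<le> x"
        using x ne unfolding tk by (cases "dropWhile (\<lambda>y. y < s) ys") auto
    qed
  qed
  moreover have "j * s \<le> sum_list (take j xs) + hinge s (mset xs)"
    by (rule take_le_hinge) (use jl xs superdominates_size[OF assms] in auto)
  moreover have "sum_list (take j xs) \<le> sum_list (take j ys)"
  proof (cases "j = 0")
    case False
    then show ?thesis
      using assms(1) jl superdominates_size[OF assms] unfolding superdominates_def xs_def ys_def
      by (auto simp: Suc_le_eq)
  qed simp
  ultimately show ?thesis unfolding xs(1)[symmetric] ys(1)[symmetric] by linarith
qed

section \<open>Fourier-Motzkin elimination with integral certificates\<close>

lemma ex_between_finite:
  fixes f g :: "'a \<Rightarrow> real"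
  assumes "finite A" "finite B" "\<And>a b. a \<in> A \<Longrightarrow> b \<in> B \<Longrightarrow> f a \<le> g b"
  shows "\<exists>t. (\<forall>a\<in>A. f a \<le> t) \<and> (\<forall>b\<in>B. t \<le> g b)"
proof (cases "A = {}")
  case True
  show ?thesis
  proof (cases "B = {}")
    case False
    then show ?thesis using True assms(2) by (intro exI[of _ "Min (g ` B)"]) auto
  qed (use True in auto)
next
  case False
  then show ?thesis
    using assms by (intro exI[of _ "Max (f ` A)"]) (auto simp: Max_le_iff)
qed

text \<open>A certificate \<open>w\<close> records multiplicities of the original inequalities whose
  combination no longer contains the variables below \<open>k\<close>. To remove variable
  \<open>k\<close>, inequalities with coefficient 0 are kept, and each one with a positive
  coefficient is paired with each one with a negative coefficient.\<close>

lemma fourier_motzkin_step: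
  fixes A :: "'i \<Rightarrow> nat \<Rightarrow> int"
  assumes fin: "finite W" and "k < n"
    and zero: "\<And>w j. w \<in> W \<Longrightarrow> j < k \<Longrightarrow> (\<Sum>i\<in>I. int (w i) * A i j) = 0"
  shows "\<exists>W'. finite W' \<and> (\<forall>w\<in>W'. \<forall>j<Suc k. (\<Sum>i\<in>I. int (w i) * A i j) = 0) \<and>
    (\<forall>\<beta> y. (\<forall>w\<in>W'. (\<Sum>j\<in>{Suc k..<n}. of_int (\<Sum>i\<in>I. int (w i) * A i j) * y j)
                     \<le> (\<Sum>i\<in>I. real (w i) * \<beta> i)) \<longrightarrow>
      (\<exists>y. \<forall>w\<in>W. (\<Sum>j\<in>{k..<n}. of_int (\<Sum>i\<in>I. int (w i) * A i j) * y j)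
                     \<le> (\<Sum>i\<in>I. real (w i) * \<beta> i)))"
proof -
  define a where "a w j = (\<Sum>i\<in>I. int (w i) * A i j)" for w :: "'i \<Rightarrow> nat" and j
  define P where "P = {w\<in>W. a w k > 0}"
  define N where "N = {w\<in>W. a w k < 0}"
  \<comment> \<open>Cross-multiplication instead of division keeps the multiplicities natural. On
    \<open>P \<times> N\<close> both factors are positive, so \<open>nat\<close> truncates
    nothing.\<close>
  define cmb where "cmb = (\<lambda>(v, w). \<lambda>i. nat (- a w k) * v i + nat (a v k) * w i :: nat)"
  define W' where "W' = {w\<in>W. a w k = 0} \<union> cmb ` (P \<times> N)"
  have PN: "finite P" "finite N" using fin by (auto simp: P_def N_def)
  have a_cmb: "a (cmb (v, w)) j = (- a w k) * a v j + a v k * a w j" if "v \<in> P" "w \<in> N" for v w j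
  proof -
    have "a (cmb (v, w)) j = (\<Sum>i\<in>I. (- a w k) * (int (v i) * A i j) + a v k * (int (w i) * A i j))"
      unfolding a_def[of "cmb (v, w)"]
      using that by (intro sum.cong) (auto simp: cmb_def P_def N_def algebra_simps)
    also have "\<dots> = (- a w k) * a v j + a v k * a w j"
      unfolding sum.distrib sum_distrib_left[symmetric] a_def ..
    finally show ?thesis .
  qed
  have 1: "finite W'" using fin PN by (auto simp: W'_def)
  have 2: "a w j = 0" if w: "w \<in> W'" and j: "j < Suc k" for w j
  proof -
    have z: "a u j = 0" if "u \<in> W" "j < k" for u using zero[OF that] by (simp add: a_def)
    show ?thesis
    proof (cases "w \<in> cmb ` (P \<times> N)")
      case True
      then obtain u v where uv: "w = cmb (u, v)" "u \<in> P" "v \<in> N" by auto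
      show ?thesis
      proof (cases "j = k")
        case True
        then show ?thesis using uv a_cmb by simp
      next
        case False
        then have "j < k" using j by simp
        then show ?thesis using uv z a_cmb by (simp add: P_def N_def)
      qed
    next
      case False
      then show ?thesis using w j z unfolding W'_def by (auto simp: less_Suc_eq)
    qed
  qed
  have 3: "\<exists>y. \<forall>w\<in>W. (\<Sum>j\<in>{k..<n}. of_int (a w j) * y j) \<le> (\<Sum>i\<in>I. real (w i) * \<beta> i)"
    if y: "\<forall>w\<in>W'. (\<Sum>j\<in>{Suc k..<n}. of_int (a w j) * y j) \<le> (\<Sum>i\<in>I. real (w i) * \<beta> i)"
    for \<beta> y
  proof -
    \<comment> \<open>With the later variables fixed at \<open>y\<close>, this is the room that
      inequality \<open>w\<close> leaves for \<open>a w k * t\<close>.\<close>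
    define b where "b w = (\<Sum>i\<in>I. real (w i) * \<beta> i) - (\<Sum>j\<in>{Suc k..<n}. of_int (a w j) * y j)" for w
    have b_cmb: "b (cmb (v, w)) = (- a w k) * b v + a v k * b w" if "v \<in> P" "w \<in> N" for v w
    proof -
      have "(\<Sum>i\<in>I. real (cmb (v, w) i) * \<beta> i)
          = (\<Sum>i\<in>I. (- a w k) * (real (v i) * \<beta> i) + a v k * (real (w i) * \<beta> i))"
        unfolding cmb_def using that by (intro sum.cong) (auto simp: P_def N_def algebra_simps)
      also have "\<dots> = (- a w k) * (\<Sum>i\<in>I. real (v i) * \<beta> i) + a v k * (\<Sum>i\<in>I. real (w i) * \<beta> i)"
        unfolding sum.distrib sum_distrib_left[symmetric] ..
      finally have e1: "(\<Sum>i\<in>I. real (cmb (v, w) i) * \<beta> i) = \<dots>" .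
      have "(\<Sum>j\<in>{Suc k..<n}. of_int (a (cmb (v, w)) j) * y j)
          = (\<Sum>j\<in>{Suc k..<n}. (- a w k) * (a v j * y j) + a v k * (a w j * y j))"
        by (intro sum.cong) (simp_all add: a_cmb[OF that] algebra_simps)
      also have "\<dots> = (- a w k) * (\<Sum>j\<in>{Suc k..<n}. a v j * y j) + a v k * (\<Sum>j\<in>{Suc k..<n}. a w j * y j)"
        unfolding sum.distrib sum_distrib_left[symmetric] ..
      finally show ?thesis unfolding b_def e1 by (simp add: algebra_simps)
    qed
    \<comment> \<open>Negative coefficients bound the new value from below and positive ones from
      above; a pair of bounds is compatible because the slack of its combined certificate is
      nonnegative.\<close>
    have "\<exists>t. (\<forall>w\<in>N. b w / a w k \<le> t) \<and> (\<forall>v\<in>P. t \<le> b v / a v k)"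
    proof (rule ex_between_finite[OF PN(2,1)])
      fix w v assume wv: "w \<in> N" "v \<in> P"
      have "cmb (v, w) \<in> W'" using wv by (auto simp: W'_def)
      then have "0 \<le> b (cmb (v, w))" using y by (simp add: b_def)
      then have "0 \<le> (- a w k) * b v + a v k * b w" using b_cmb wv by simp
      moreover have "real_of_int (a w k) < 0" "0 < real_of_int (a v k)" using wv by (auto simp: P_def N_def)
      ultimately show "b w / a w k \<le> b v / a v k"
        by (simp add: field_simps)
    qed
    then obtain t where t: "\<forall>w\<in>N. b w / a w k \<le> t" "\<forall>v\<in>P. t \<le> b v / a v k" by blast
    have main: "a w k * t \<le> b w" if w: "w \<in> W" for w
    proof -
      consider "w \<in> P" | "w \<in> N" | "a w k = 0" using w by (force simp: P_def N_def)
      then show ?thesis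
      proof cases
        case 1
        then have "t \<le> b w / a w k" "0 < real_of_int (a w k)" using t by (auto simp: P_def)
        then show ?thesis by (simp add: field_simps)
      next
        case 2
        then have "b w / a w k \<le> t" "real_of_int (a w k) < 0" using t by (auto simp: N_def)
        then show ?thesis by (simp add: field_simps)
      next
        case 3
        then have "w \<in> W'" using w by (simp add: W'_def)
        then show ?thesis using y 3 by (simp add: b_def)
      qed
    qed
    have "(\<Sum>j\<in>{k..<n}. of_int (a w j) * (y(k := t)) j) \<le> (\<Sum>i\<in>I. real (w i) * \<beta> i)"
      if w: "w \<in> W" for w
    proof -
      have "(\<Sum>j\<in>{k..<n}. of_int (a w j) * (y(k := t)) j)
          = a w k * t + (\<Sum>j\<in>{Suc k..<n}. of_int (a w j) * (y(k := t)) j)"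
        using \<open>k < n\<close> by (simp add: sum.atLeast_Suc_lessThan)
      also have "(\<Sum>j\<in>{Suc k..<n}. of_int (a w j) * (y(k := t)) j) = (\<Sum>j\<in>{Suc k..<n}. of_int (a w j) * y j)"
        by (intro sum.cong) auto
      finally show ?thesis using main[OF w] by (simp add: b_def)
    qed
    then show ?thesis by blast
  qed
  show ?thesis
    using 1 2 3 unfolding a_def by (intro exI[of _ W']) blast
qed

text \<open>The certificates \<open>W\<close> do not depend on the right-hand side \<open>\<beta>\<close>: this is what bounds \<open>k\<close> when the
  lemma is applied to the systems whose right-hand sides are given by the points of \<open>T d k\<close>.\<close>

lemma fourier_motzkin:
  fixes A :: "'i \<Rightarrow> nat \<Rightarrow> int"
  assumes "finite I"
  shows "\<exists>W. finite W \<and> (\<forall>w\<in>W. \<forall>j<n. (\<Sum>i\<in>I. int (w i) * A i j) = 0) \<and>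
    (\<forall>\<beta> :: 'i \<Rightarrow> real. (\<forall>w\<in>W. 0 \<le> (\<Sum>i\<in>I. real (w i) * \<beta> i)) \<longrightarrow>
      (\<exists>y. \<forall>i\<in>I. (\<Sum>j<n. of_int (A i j) * y j) \<le> \<beta> i))"
proof -
  have "\<exists>W. finite W \<and> (\<forall>w\<in>W. \<forall>j<k. (\<Sum>i\<in>I. int (w i) * A i j) = 0) \<and>
    (\<forall>\<beta> y. (\<forall>w\<in>W. (\<Sum>j\<in>{k..<n}. of_int (\<Sum>i\<in>I. int (w i) * A i j) * y j)
                     \<le> (\<Sum>i\<in>I. real (w i) * \<beta> i)) \<longrightarrow>
      (\<exists>y. \<forall>i\<in>I. (\<Sum>j<n. of_int (A i j) * y j) \<le> \<beta> i))" if "k \<le> n" for k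
    using that
  proof (induction k)
    case 0
    \<comment> \<open>Before any elimination, each original inequality is its own certificate,
      encoded by a unit vector.\<close>
    define e where "e = (\<lambda>i j :: 'i. if i = j then 1 else 0 :: nat)"
    have e: "(\<Sum>i'\<in>I. int (e i i') * A i' j) = A i j" if "i \<in> I" for i j
    proof -
      have "(\<Sum>i'\<in>I. int (e i i') * A i' j) = (\<Sum>i'\<in>I. if i = i' then A i' j else 0)"
        by (intro sum.cong) (auto simp: e_def)
      then show ?thesis using that assms by simp
    qed
    have e': "(\<Sum>i'\<in>I. real (e i i') * \<beta> i') = \<beta> i" if "i \<in> I" for i and \<beta> :: "'i \<Rightarrow> real"
    proof -
      have "(\<Sum>i'\<in>I. real (e i i') * \<beta> i') = (\<Sum>i'\<in>I. if i = i' then \<beta> i' else 0)"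
        by (intro sum.cong) (auto simp: e_def)
      then show ?thesis using that assms by simp
    qed
    show ?case
    proof (intro exI[of _ "e ` I"] conjI allI impI)
      fix \<beta> :: "'i \<Rightarrow> real" and y
      assume h: "\<forall>w\<in>e ` I. (\<Sum>j\<in>{0..<n}. of_int (\<Sum>i\<in>I. int (w i) * A i j) * y j)
                     \<le> (\<Sum>i\<in>I. real (w i) * \<beta> i)"
      show "\<exists>y. \<forall>i\<in>I. (\<Sum>j<n. of_int (A i j) * y j) \<le> \<beta> i"
      proof (intro exI ballI)
        fix i assume "i \<in> I"
        then show "(\<Sum>j<n. of_int (A i j) * y j) \<le> \<beta> i"
          using h[rule_format, of "e i"] by (simp only: e e' imageI atLeast0LessThan)
      qed
    qed (use assms in auto)
  next
    case (Suc k)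
    then obtain W where W: "finite W" "\<forall>w\<in>W. \<forall>j<k. (\<Sum>i\<in>I. int (w i) * A i j) = 0"
      "\<forall>\<beta> y. (\<forall>w\<in>W. (\<Sum>j\<in>{k..<n}. of_int (\<Sum>i\<in>I. int (w i) * A i j) * y j)
                     \<le> (\<Sum>i\<in>I. real (w i) * \<beta> i)) \<longrightarrow>
      (\<exists>y. \<forall>i\<in>I. (\<Sum>j<n. of_int (A i j) * y j) \<le> \<beta> i)" by auto
    from fourier_motzkin_step[OF W(1), of k n A I] W(2) Suc.prems
    obtain W' where W': "finite W'" "\<forall>w\<in>W'. \<forall>j<Suc k. (\<Sum>i\<in>I. int (w i) * A i j) = 0"
      "\<forall>\<beta> y. (\<forall>w\<in>W'. (\<Sum>j\<in>{Suc k..<n}. of_int (\<Sum>i\<in>I. int (w i) * A i j) * y j)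
                     \<le> (\<Sum>i\<in>I. real (w i) * \<beta> i)) \<longrightarrow>
      (\<exists>y. \<forall>w\<in>W. (\<Sum>j\<in>{k..<n}. of_int (\<Sum>i\<in>I. int (w i) * A i j) * y j)
                     \<le> (\<Sum>i\<in>I. real (w i) * \<beta> i))" by auto
    show ?case
      using W' W(3) by (intro exI[of _ W']) blast
  qed
  \<comment> \<open>With every variable eliminated the left-hand sums are empty, and only sign
    conditions on the weighted right-hand sides remain.\<close>
  from this[of n] show ?thesis by simp
qed


section \<open>Log-convexity of power sums\<close>

text \<open>As a function of \<open>r\<close>, the hinge at \<open>s\<close> has second difference 1
  at the kink \<open>s = r + 1\<close> and 0 elsewhere. Both sides thus have equal second
  differences and vanish from \<open>d\<close> on, so induction descends from
  \<open>d\<close>.\<close>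

lemma sum_of_second_differences:
  fixes f :: "nat \<Rightarrow> real"
  assumes "\<And>r. r \<ge> d \<Longrightarrow> f r = 0" "1 \<le> r"
  shows "f r = (\<Sum>s\<in>{1..d}. (f (s + 1) - 2 * f s + f (s - 1)) * real (s - r))"
  using assms(2)
proof (induction "d - r" arbitrary: r rule: less_induct)
  case less
  define D where "D s = f (s + 1) - 2 * f s + f (s - 1)" for s
  define F where "F r = (\<Sum>s\<in>{1..d}. D s * real (s - r))" for r
  show ?case
  proof (cases "d \<le> r")
    case True
    then show ?thesis using assms(1) by simp
  next
    case False
    have "f (r + 1) = F (r + 1)" "f (r + 2) = F (r + 2)"
      using less.hyps[of "r + 1"] less.hyps[of "r + 2"] False unfolding F_def D_def by auto
    moreover have "F r - 2 * F (r + 1) + F (r + 2) = (\<Sum>s\<in>{1..d}. if s = r + 1 then D s else 0)"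
      unfolding F_def sum_distrib_left sum_subtractf[symmetric] sum.distrib[symmetric]
    proof (intro sum.cong refl)
      fix s
      have "real (s - r) - 2 * real (s - (r + 1)) + real (s - (r + 2)) = (if s = r + 1 then 1 else 0)"
        by (cases "s \<le> r") auto
      then have "D s * (real (s - r) - 2 * real (s - (r + 1)) + real (s - (r + 2)))
          = (if s = r + 1 then D s else 0)" by simp
      then show "D s * real (s - r) - 2 * (D s * real (s - (r + 1))) + D s * real (s - (r + 2))
          = (if s = r + 1 then D s else 0)" by (simp only: algebra_simps)
    qed
    moreover have "\<dots> = D (r + 1)" using False by simp
    ultimately have "f r = F r" by (simp add: D_def)
    then show ?thesis by (simp add: F_def D_def)
  qed
qed

text \<open>Continuing \<open>y\<close> linearly through the origin beyond \<open>d\<close> keeps it convex, by the last hypothesis.\<close>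

lemma convex_sequence_hinge_decomposition:
  fixes y :: "nat \<Rightarrow> real"
  assumes "d \<ge> 2"
    and conv: "\<And>r. 1 \<le> r \<Longrightarrow> r + 2 \<le> d \<Longrightarrow> 2 * y (r + 1) \<le> y r + y (r + 2)"
    and last: "real (d - 1) * y d \<le> real d * y (d - 1)"
  shows "\<exists>B U. (\<forall>s. 0 \<le> U s) \<and>
    (\<forall>r\<in>{1..d}. y r = B * real r + (\<Sum>s\<in>{1..d}. U s * real (s - r)))"
proof -
  \<comment> \<open>The slope of the line through the origin and the point \<open>(d, y d)\<close>;
    subtracting this line makes \<open>f\<close> vanish at \<open>d\<close>.\<close>
  define B where "B = y d / d"
  define f where "f r = (if d \<le> r then 0 else y r - B * r)" for r
  \<comment> \<open>The weight at \<open>s = 1\<close> can be set to 0 since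
    \<open>1 - r = 0\<close> for \<open>r \<ge> 1\<close>; the second difference there would involve
    \<open>y 0\<close>, about which nothing is assumed.\<close>
  define U where "U s = (if 2 \<le> s \<and> s \<le> d then f (s + 1) - 2 * f s + f (s - 1) else 0)" for s
  have Bd: "B * d = y d" using assms(1) by (simp add: B_def)
  have "0 \<le> U s" for s
  proof (cases "2 \<le> s \<and> s \<le> d")
    case True
    then obtain r where r: "s = r + 1" "1 \<le> r" using that[of "s - 1"] by auto
    consider "r + 2 < d" | "r + 2 = d" | "r + 1 = d" using True r by linarith
    then show ?thesis
    proof cases
      case 1
      then show ?thesis using conv[of r] r True by (simp add: U_def f_def algebra_simps)
    next
      case 2
      then have "real d = r + 2" by simp
      then have "y d = B * (r + 2)" using Bd by simp
      then show ?thesis using conv[of r] r True 2 by (simp add: U_def f_def algebra_simps)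
    next
      \<comment> \<open>At the last kink the second difference is just \<open>f (d - 1)\<close>,
        whose sign is given by \<open>last\<close>.\<close>
      case 3
      then have d: "real d = r + 1" by simp
      then have "real r * (B * d) \<le> real d * y r" using last 3 Bd by auto
      then have "d * (B * r) \<le> d * y r" by (simp add: algebra_simps)
      then have "B * r \<le> y r" using assms(1) by simp
      then show ?thesis using r True 3 by (simp add: U_def f_def 3[symmetric])
    qed
  qed (auto simp: U_def)
  moreover have "y r = B * real r + (\<Sum>s\<in>{1..d}. U s * real (s - r))" if r: "r \<in> {1..d}" for r
  proof -
    have "f r = (\<Sum>s\<in>{1..d}. (f (s + 1) - 2 * f s + f (s - 1)) * real (s - r))"
      using r by (intro sum_of_second_differences) (auto simp: f_def)
    also have "\<dots> = (\<Sum>s\<in>{1..d}. U s * real (s - r))"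
      using r by (intro sum.cong) (auto simp: U_def)
    finally have "f r = (\<Sum>s\<in>{1..d}. U s * real (s - r))" .
    moreover have "f r = y r - B * r" using r Bd by (auto simp: f_def)
    ultimately show ?thesis by simp
  qed
  ultimately show ?thesis by blast
qed

lemma power_sum_even_pos:
  assumes "i \<in> {1..n}" "X i \<noteq> 0" "even r"
  shows "0 < power_sum n r X"
  unfolding power_sum_def
  using assms by (intro sum_pos2[of _ i]) (auto simp: zero_less_power_eq zero_le_even_power)

text \<open>Cauchy-Schwarz for the vectors \<open>X i ^ r\<close> and
  \<open>X i ^ (r + 2)\<close>.\<close>

lemma power_sum_log_convex:
  "(power_sum n (2 * (r + 1)) X)\<^sup>2 \<le> power_sum n (2 * r) X * power_sum n (2 * (r + 2)) X"
proof -
  have "(\<Sum>i\<in>{1..n}. X i ^ r * X i ^ (r + 2))\<^sup>2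
      \<le> (\<Sum>i\<in>{1..n}. (X i ^ r)\<^sup>2) * (\<Sum>i\<in>{1..n}. (X i ^ (r + 2))\<^sup>2)"
    by (rule Cauchy_Schwarz_ineq_sum)
  also have "(\<Sum>i\<in>{1..n}. X i ^ r * X i ^ (r + 2)) = power_sum n (2 * (r + 1)) X"
    unfolding power_sum_def power_add[symmetric] by (intro sum.cong arg_cong[of _ _ "\<lambda>k. _ ^ k"]) auto
  finally show ?thesis
    by (simp only: power_sum_def power_even_eq)
qed

text \<open>Monotonicity of the p-norms in the exponent: one factor \<open>(X i)\<^sup>2\<close> of
  each term is bounded by the \<open>r\<close>-th root of the whole power sum. It provides the
  endpoint condition of the hinge decomposition.\<close>

lemma power_sum_norm_antimono:
  assumes "r \<ge> 1" and pos: "0 < power_sum n (2 * r) X"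
  shows "power_sum n (2 * (r + 1)) X \<le> power_sum n (2 * r) X powr (1 + 1 / r)"
proof -
  define P where "P = power_sum n (2 * r) X"
  have le: "(X i)\<^sup>2 \<le> P powr (1 / r)" if "i \<in> {1..n}" for i
  proof (cases "X i = 0")
    case False
    have "((X i)\<^sup>2) ^ r \<le> P"
      unfolding P_def power_sum_def power_mult[symmetric]
      using that by (intro member_le_sum) (auto simp: zero_le_even_power)
    then have "(((X i)\<^sup>2) ^ r) powr (1 / r) \<le> P powr (1 / r)"
      by (intro powr_mono2) auto
    moreover have "(((X i)\<^sup>2) ^ r) powr (1 / r) = (X i)\<^sup>2"
      using False assms(1) by (simp add: powr_realpow[symmetric] powr_powr)
    ultimately show ?thesis by simp
  qed simp
  have "power_sum n (2 * (r + 1)) X = (\<Sum>i\<in>{1..n}. X i ^ (2 * r) * (X i)\<^sup>2)"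
    by (simp add: power_sum_def power_add[symmetric])
  also have "\<dots> \<le> (\<Sum>i\<in>{1..n}. X i ^ (2 * r) * P powr (1 / r))"
    using le by (intro sum_mono mult_left_mono) (auto simp: zero_le_even_power)
  also have "\<dots> = P powr (1 + 1 / r)"
    using pos by (simp add: powr_add P_def power_sum_def sum_distrib_right[symmetric])
  finally show ?thesis by (simp add: P_def)
qed

lemma ln_power_sum_hinge_decomposition:
  assumes "d \<ge> 2" "i \<in> {1..n}" "X i \<noteq> 0"
  shows "\<exists>B U. (\<forall>s. 0 \<le> U s) \<and> (\<forall>r. even r \<longrightarrow> 0 < r \<longrightarrow> r \<le> 2 * d \<longrightarrow>
    ln (power_sum n r X) = B * real r + (\<Sum>s\<in>{1..d}. U s * real (2 * s - r)))"
proof -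
  define y where "y r = ln (power_sum n (2 * r) X)" for r
  have pos: "0 < power_sum n (2 * r) X" for r
    using power_sum_even_pos[where X = X, OF assms(2,3)] by simp
  have "\<exists>B U. (\<forall>s. 0 \<le> U s) \<and>
    (\<forall>r\<in>{1..d}. y r = B * real r + (\<Sum>s\<in>{1..d}. U s * real (s - r)))"
  proof (rule convex_sequence_hinge_decomposition[OF assms(1)])
    fix r
    have "ln ((power_sum n (2 * (r + 1)) X)\<^sup>2)
        \<le> ln (power_sum n (2 * r) X * power_sum n (2 * (r + 2)) X)"
      using power_sum_log_convex[of n r X] pos[of r] pos[of "r + 1"] pos[of "r + 2"]
      by (subst ln_le_cancel_iff) auto
    then show "2 * y (r + 1) \<le> y r + y (r + 2)"
      using pos[of r] pos[of "r + 1"] pos[of "r + 2"]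
      by (simp add: y_def ln_mult ln_realpow)
  next
    obtain r where r: "d = r + 1" "r \<ge> 1" using assms(1) that[of "d - 1"] by auto
    have "ln (power_sum n (2 * (r + 1)) X) \<le> ln (power_sum n (2 * r) X powr (1 + 1 / r))"
      using power_sum_norm_antimono[OF r(2) pos[of r]] pos[of r] pos[of "r + 1"]
      by (subst ln_le_cancel_iff) auto
    then have "y (r + 1) \<le> (1 + 1 / r) * y r"
      using pos[of r] by (simp add: y_def ln_powr)
    then show "real (d - 1) * y d \<le> real d * y (d - 1)"
      using r by (simp add: field_simps)
  qed
  then obtain B U where BU: "\<And>s. 0 \<le> U s"
    "\<And>r. r \<in> {1..d} \<Longrightarrow> y r = B * real r + (\<Sum>s\<in>{1..d}. U s * real (s - r))" by blast
  show ?thesis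
  \<comment> \<open>The decomposition was obtained in terms of half the exponent; passing from
    \<open>q\<close> to \<open>2 * q\<close> doubles the linear term and all hinges, hence the
    halves.\<close>
  proof (intro exI[of _ "B / 2"] exI[of _ "\<lambda>s. U s / 2"] conjI allI impI)
    fix r :: nat assume "even r" "0 < r" "r \<le> 2 * d"
    then obtain q where q: "r = 2 * q" "q \<in> {1..d}" by (auto elim!: evenE)
    have "real (2 * s - 2 * q) = 2 * real (s - q)" for s
      by (simp flip: diff_mult_distrib2)
    then show "ln (power_sum n r X) = B / 2 * real r + (\<Sum>s\<in>{1..d}. U s / 2 * real (2 * s - r))"
      using BU(2)[OF q(2)] by (simp add: q(1) y_def)
  qed (simp add: BU)
qed

section \<open>Superdominance inequalities for products of power sums\<close>

lemma sum_mset_hinge_decomposition: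
  fixes g U :: "nat \<Rightarrow> real"
  assumes "\<And>r. r \<in># \<alpha> \<Longrightarrow> g r = B * real r + (\<Sum>s\<in>S. U s * real (h s - r))"
  shows "(\<Sum>r\<in>#\<alpha>. g r) = B * real (sum_mset \<alpha>) + (\<Sum>s\<in>S. U s * real (hinge (h s) \<alpha>))"
  using assms
  by (induction \<alpha>) (simp_all add: hinge_def algebra_simps sum.distrib sum_distrib_left)

lemma power_sum_partition_pos:
  assumes "\<And>r. r \<in># \<alpha> \<Longrightarrow> 0 < power_sum n r X"
  shows "0 < power_sum_partition n \<alpha> X"
  using assms unfolding power_sum_partition_def by (induction \<alpha>) auto

lemma ln_power_sum_partition:
  assumes "\<And>r. r \<in># \<alpha> \<Longrightarrow> 0 < power_sum n r X"
  shows "ln (power_sum_partition n \<alpha> X) = (\<Sum>r\<in>#\<alpha>. ln (power_sum n r X))"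
  using assms
proof (induction \<alpha>)
  case (add r \<alpha>)
  then have "0 < power_sum_partition n \<alpha> X" by (intro power_sum_partition_pos) auto
  moreover have "0 < power_sum n r X" using add.prems by simp
  ultimately show ?case using add by (simp add: power_sum_partition_def ln_mult_pos)
qed (simp add: power_sum_partition_def)

lemma even_partitionsD:
  assumes "\<alpha> \<in> even_partitions d"
  shows "sum_mset \<alpha> = 2 * d" "\<And>r. r \<in># \<alpha> \<Longrightarrow> even r" "\<And>r. r \<in># \<alpha> \<Longrightarrow> 0 < r" "\<And>r. r \<in># \<alpha> \<Longrightarrow> r \<le> 2 * d"
proof -
  show s: "sum_mset \<alpha> = 2 * d" "\<And>r. r \<in># \<alpha> \<Longrightarrow> even r" "\<And>r. r \<in># \<alpha> \<Longrightarrow> 0 < r"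
    using assms by (auto simp: even_partitions_def partitions_def)
  show "r \<le> 2 * d" if "r \<in># \<alpha>" for r
    using that s(1) by (auto dest!: multi_member_split)
qed

text \<open>Both fusions have total \<open>2 * d * k\<close> and positive parts at most
  \<open>2 * d\<close>, so the hinge criterion applies with finitely many thresholds. The order
  condition in \<open>T\<close> thereby becomes a finite system of linear inequalities.\<close>

lemma fusion_superdominates_iff:
  assumes "\<And>i. i \<in> {1..k} \<Longrightarrow> \<Lambda> i \<in> even_partitions d" "\<mu> \<in> even_partitions d"
  shows "fusion k \<Lambda> \<succeq> fusion k (\<lambda>_. \<mu>) \<longleftrightarrow>
    (\<forall>s\<le>2 * d. k * hinge s \<mu> \<le> (\<Sum>i\<in>{1..k}. hinge s (\<Lambda> i)))"
proof -
  have mem: "\<exists>i\<in>{1..k}. r \<in># \<Lambda> i" if "r \<in># fusion k \<Lambda>" for r \<Lambda>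
    using that by (simp add: fusion_def set_mset_sum)
  have sum: "sum_mset (fusion k \<Lambda>) = (\<Sum>i\<in>{1..k}. sum_mset (\<Lambda> i))" for \<Lambda>
    unfolding fusion_def by (induction k) auto
  have "sum_mset (fusion k \<Lambda>) = sum_mset (fusion k (\<lambda>_. \<mu>))"
    unfolding sum using assms by (intro sum.cong) (simp_all add: even_partitionsD(1))
  moreover have "0 < r" if "r \<in># fusion k (\<lambda>_. \<mu>)" for r
    using mem[OF that] assms(2) even_partitionsD by auto
  moreover have "s \<le> 2 * d" if "s \<in># fusion k \<Lambda>" for s
    using mem[OF that] assms(1) even_partitionsD by blast
  ultimately have "fusion k \<Lambda> \<succeq> fusion k (\<lambda>_. \<mu>) \<longleftrightarrow>
    (\<forall>s\<le>2 * d. hinge s (fusion k (\<lambda>_. \<mu>)) \<le> hinge s (fusion k \<Lambda>))"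
    using superdominates_hinge_le superdominates_if_hinge_le by metis
  then show ?thesis by (simp add: fusion_def hinge_sum)
qed

text \<open>The logarithm of each product is a constant shared by all partitions of
  \<open>2 * d\<close> plus a nonnegative combination of hinge sums, so the hinge inequalities can
  be added up.\<close>

lemma ln_power_sum_partition_fusion_le:
  assumes "d \<ge> 2" "i0 \<in> {1..n}" "X i0 \<noteq> 0"
    and \<Lambda>: "\<And>i. i \<in> {1..k} \<Longrightarrow> \<Lambda> i \<in> even_partitions d" and \<mu>: "\<mu> \<in> even_partitions d"
    and dom: "fusion k \<Lambda> \<succeq> fusion k (\<lambda>_. \<mu>)"
  shows "k * ln (power_sum_partition n \<mu> X) \<le> (\<Sum>i\<in>{1..k}. ln (power_sum_partition n (\<Lambda> i) X))"
proof -
  obtain B U where U: "\<And>s. 0 \<le> U s" and BU: "\<And>r. even r \<Longrightarrow> 0 < r \<Longrightarrow> r \<le> 2 * d \<Longrightarrow>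
    ln (power_sum n r X) = B * real r + (\<Sum>s\<in>{1..d}. U s * real (2 * s - r))"
    using ln_power_sum_hinge_decomposition[of d i0 n X, OF assms(1-3)] by blast
  have eq: "ln (power_sum_partition n \<alpha> X) = B * real (2 * d) + (\<Sum>s\<in>{1..d}. U s * real (hinge (2 * s) \<alpha>))"
    if "\<alpha> \<in> even_partitions d" for \<alpha>
  proof -
    have "ln (power_sum_partition n \<alpha> X) = (\<Sum>r\<in>#\<alpha>. ln (power_sum n r X))"
      using power_sum_even_pos[where X = X, OF assms(2,3)] even_partitionsD(2)[OF that]
      by (intro ln_power_sum_partition) auto
    also have "\<dots> = B * real (sum_mset \<alpha>) + (\<Sum>s\<in>{1..d}. U s * real (hinge (2 * s) \<alpha>))"
      using BU even_partitionsD[OF that] by (intro sum_mset_hinge_decomposition) auto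
    finally show ?thesis using even_partitionsD(1)[OF that] by simp
  qed
  have le: "k * hinge s \<mu> \<le> (\<Sum>i\<in>{1..k}. hinge s (\<Lambda> i))" if "s \<le> 2 * d" for s
    using dom fusion_superdominates_iff[of k \<Lambda> d \<mu>, OF \<Lambda> \<mu>] that by simp
  have "k * ln (power_sum_partition n \<mu> X)
      = k * (B * real (2 * d)) + (\<Sum>s\<in>{1..d}. U s * real (k * hinge (2 * s) \<mu>))"
    by (simp add: eq[OF \<mu>] sum_distrib_left algebra_simps)
  also have "\<dots> \<le> k * (B * real (2 * d)) + (\<Sum>s\<in>{1..d}. U s * real (\<Sum>i\<in>{1..k}. hinge (2 * s) (\<Lambda> i)))"
    using le U by (intro add_left_mono sum_mono mult_left_mono of_nat_mono) auto
  also have "(\<Sum>s\<in>{1..d}. U s * real (\<Sum>i\<in>{1..k}. hinge (2 * s) (\<Lambda> i)))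
     = (\<Sum>i\<in>{1..k}. \<Sum>s\<in>{1..d}. U s * real (hinge (2 * s) (\<Lambda> i)))"
    unfolding of_nat_sum sum_distrib_left by (rule sum.swap)
  also have "k * (B * real (2 * d)) + \<dots> = (\<Sum>i\<in>{1..k}. ln (power_sum_partition n (\<Lambda> i) X))"
    by (simp add: eq \<Lambda> sum.distrib)
  finally show ?thesis .
qed


section \<open>Inequalities on the dual cone\<close>

text \<open>The members of the family may coincide; a coefficient therefore collects the weights of
  all indices with the same partition.\<close>

lemma sum_family_indicators:
  fixes f :: "'a \<Rightarrow> real"
  assumes "finite A" "\<And>i. i \<in> I \<Longrightarrow> \<Lambda> i \<in> A" "\<mu> \<in> A"
  shows "(\<Sum>\<alpha>\<in>A. ((\<Sum>i\<in>I. if \<alpha> = \<Lambda> i then a i else 0) - (if \<alpha> = \<mu> then b else 0)) * f \<alpha>)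
    = (\<Sum>i\<in>I. a i * f (\<Lambda> i)) - b * f \<mu>"
proof -
  have "(\<Sum>\<alpha>\<in>A. \<Sum>i\<in>I. (if \<alpha> = \<Lambda> i then a i else 0) * f \<alpha>)
      = (\<Sum>i\<in>I. \<Sum>\<alpha>\<in>A. (if \<alpha> = \<Lambda> i then a i else 0) * f \<alpha>)"
    by (rule sum.swap)
  also have "\<dots> = (\<Sum>i\<in>I. \<Sum>\<alpha>\<in>A. if \<alpha> = \<Lambda> i then a i * f \<alpha> else 0)"
    by (intro sum.cong) auto
  also have "\<dots> = (\<Sum>i\<in>I. a i * f (\<Lambda> i))"
    using assms by (intro sum.cong) auto
  finally have 1: "(\<Sum>\<alpha>\<in>A. \<Sum>i\<in>I. (if \<alpha> = \<Lambda> i then a i else 0) * f \<alpha>) = \<dots>" .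
  have "(\<Sum>\<alpha>\<in>A. (if \<alpha> = \<mu> then b else 0) * f \<alpha>) = (\<Sum>\<alpha>\<in>A. if \<alpha> = \<mu> then b * f \<alpha> else 0)"
    by (intro sum.cong) auto
  also have "\<dots> = b * f \<mu>" using assms by simp
  finally show ?thesis
    using 1 by (simp add: left_diff_distrib sum_subtractf sum_distrib_right)
qed

text \<open>By \<open>1 + x \<le> exp x\<close>, a sum of \<open>k\<close> power sum products \<open>p (\<Lambda> i)\<close> with weights of product 1 dominates \<open>k * p \<mu>\<close>.
  Tuning the weights to \<open>\<phi>\<close> turns the resulting linear inequality into the multiplicative one.\<close>

lemma BP_dual_ln_le:
  assumes d: "d \<ge> 2" and k: "k \<ge> 1" and \<phi>: "\<phi> \<in> BP_dual d"
    and pos: "\<And>\<alpha>. \<alpha> \<in> even_partitions d \<Longrightarrow> 0 < \<phi> \<alpha>"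
    and \<Lambda>: "\<And>i. i \<in> {1..k} \<Longrightarrow> \<Lambda> i \<in> even_partitions d" and \<mu>: "\<mu> \<in> even_partitions d"
    and dom: "fusion k \<Lambda> \<succeq> fusion k (\<lambda>_. \<mu>)"
  shows "k * ln (\<phi> \<mu>) \<le> (\<Sum>i\<in>{1..k}. ln (\<phi> (\<Lambda> i)))"
proof -
  \<comment> \<open>\<open>exp G\<close> is the geometric mean of the values
    \<open>\<phi> (\<Lambda> i)\<close>. The weights \<open>a i\<close> have product 1 and make
    every \<open>a i * \<phi> (\<Lambda> i)\<close> equal to \<open>exp G\<close>.\<close>
  define G where "G = (\<Sum>i\<in>{1..k}. ln (\<phi> (\<Lambda> i))) / k"
  define a where "a i = exp (G - ln (\<phi> (\<Lambda> i)))" for i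
  have suma: "(\<Sum>i\<in>{1..k}. ln (a i)) = 0"
    using k by (simp add: a_def sum_subtractf G_def)
  define c where "c = restrict (\<lambda>\<alpha>. (\<Sum>i\<in>{1..k}. if \<alpha> = \<Lambda> i then a i else 0) - (if \<alpha> = \<mu> then real k else 0))
    (even_partitions d)"
  have pair: "(\<Sum>\<alpha>\<in>even_partitions d. c \<alpha> * f \<alpha>) = (\<Sum>i\<in>{1..k}. a i * f (\<Lambda> i)) - k * f \<mu>"
    for f :: "_ \<Rightarrow> real"
    using sum_family_indicators[OF finite_even_partitions, of "{1..k}" \<Lambda> d \<mu> a "real k" f] \<Lambda> \<mu>
    by (simp add: c_def)
  have "c \<in> BP d"
    unfolding BP_def mem_Collect_eq
  proof (intro conjI allI impI)
    show "c \<in> even_partitions d \<rightarrow>\<^sub>E UNIV" by (simp add: c_def)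
    fix n X assume n: "2 * d \<le> n"
    have "0 \<le> (\<Sum>i\<in>{1..k}. a i * power_sum_partition n (\<Lambda> i) X) - k * power_sum_partition n \<mu> X"
    proof (cases "\<exists>i\<in>{1..n}. X i \<noteq> 0")
      case False
      have "power_sum_partition n \<alpha> X = 0" if "\<alpha> \<in> even_partitions d" for \<alpha>
      proof -
        have "\<alpha> \<noteq> {#}" using even_partitionsD(1)[OF that] d by auto
        then obtain r where "r \<in># \<alpha>" by blast
        moreover from this have "power_sum n r X = 0"
          unfolding power_sum_def using False even_partitionsD(3)[OF that] by (intro sum.neutral) (auto simp: power_0_left)
        ultimately show ?thesis unfolding power_sum_partition_def by (auto simp: prod_mset_zero_iff)
      qed
      then show ?thesis using \<Lambda> \<mu> by simp
    next
      case True
      then obtain i0 where i0: "i0 \<in> {1..n}" "X i0 \<noteq> 0" by blast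
      define p where "p \<alpha> = power_sum_partition n \<alpha> X" for \<alpha>
      have p: "0 < p \<alpha>" if "\<alpha> \<in> even_partitions d" for \<alpha>
        unfolding p_def using even_partitionsD(2)[OF that] power_sum_even_pos[of i0 n X] i0
        by (intro power_sum_partition_pos) auto
      have le: "k * ln (p \<mu>) \<le> (\<Sum>i\<in>{1..k}. ln (p (\<Lambda> i)))"
        unfolding p_def by (rule ln_power_sum_partition_fusion_le[where X = X and \<Lambda> = \<Lambda>, OF d i0 \<Lambda> \<mu> dom])
      have "p \<mu> * (1 + (ln (a i) + ln (p (\<Lambda> i)) - ln (p \<mu>))) \<le> a i * p (\<Lambda> i)" if "i \<in> {1..k}" for i
      proof -
        have "1 + (ln (a i) + ln (p (\<Lambda> i)) - ln (p \<mu>)) \<le> exp (ln (a i) + ln (p (\<Lambda> i)) - ln (p \<mu>))"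
          by (rule exp_ge_add_one_self)
        also have "\<dots> = a i * p (\<Lambda> i) / p \<mu>"
          using p[OF \<mu>] p[OF \<Lambda>[OF that]] by (simp add: exp_add exp_diff a_def)
        finally show ?thesis using p[OF \<mu>] by (simp add: field_simps)
      qed
      then have "(\<Sum>i\<in>{1..k}. p \<mu> * (1 + (ln (a i) + ln (p (\<Lambda> i)) - ln (p \<mu>)))) \<le> (\<Sum>i\<in>{1..k}. a i * p (\<Lambda> i))"
        by (intro sum_mono) auto
      also have "(\<Sum>i\<in>{1..k}. p \<mu> * (1 + (ln (a i) + ln (p (\<Lambda> i)) - ln (p \<mu>))))
          = p \<mu> * (k + ((\<Sum>i\<in>{1..k}. ln (p (\<Lambda> i))) - k * ln (p \<mu>)))"
        using suma by (simp add: sum_distrib_left[symmetric] sum.distrib sum_subtractf)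
      finally have "p \<mu> * (k + ((\<Sum>i\<in>{1..k}. ln (p (\<Lambda> i))) - k * ln (p \<mu>))) \<le> (\<Sum>i\<in>{1..k}. a i * p (\<Lambda> i))" .
      moreover have "p \<mu> * k \<le> p \<mu> * (k + ((\<Sum>i\<in>{1..k}. ln (p (\<Lambda> i))) - k * ln (p \<mu>)))"
        using le p[OF \<mu>] by (intro mult_left_mono) auto
      ultimately show ?thesis by (simp add: p_def mult.commute)
    qed
    then show "0 \<le> (\<Sum>\<alpha>\<in>even_partitions d. c \<alpha> * power_sum_partition n \<alpha> X)"
      unfolding pair .
  qed
  then have "0 \<le> (\<Sum>i\<in>{1..k}. a i * \<phi> (\<Lambda> i)) - k * \<phi> \<mu>"
    using \<phi> unfolding BP_dual_def pair[symmetric] by blast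
  also have "(\<Sum>i\<in>{1..k}. a i * \<phi> (\<Lambda> i)) = (\<Sum>i\<in>{1..k}. exp G)"
    by (intro sum.cong refl) (use pos[OF \<Lambda>] in \<open>force simp: a_def exp_diff\<close>)
  finally have "k * \<phi> \<mu> \<le> k * exp G" by simp
  then have "\<phi> \<mu> \<le> exp G" using k by simp
  then have "ln (\<phi> \<mu>) \<le> G" using pos[OF \<mu>] by (simp add: ln_ge_iff flip: ln_le_cancel_iff)
  then show ?thesis using k by (simp add: G_def field_simps)
qed

text \<open>The inequality between logarithms is homogeneous, so it holds in every base greater than
  1 and survives the limit.\<close>

lemma trop_BP_dual_subset_T:
  assumes "d \<ge> 2" "k \<ge> 1"
  shows "trop (even_partitions d) (BP_dual d) \<subseteq> T d k"
proof
  fix y assume "y \<in> trop (even_partitions d) (BP_dual d)"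
  then obtain x :: "nat \<Rightarrow> nat multiset \<Rightarrow> real" and \<tau> :: "nat \<Rightarrow> real" where
    y: "y \<in> even_partitions d \<rightarrow>\<^sub>E UNIV" and
    x: "\<And>m. x m \<in> BP_dual d" "\<And>m. x m \<in> even_partitions d \<rightarrow>\<^sub>E {0<..}" and
    \<tau>: "\<And>m. \<tau> m \<in> {0<..<1}" and
    lim: "\<And>i. i \<in> even_partitions d \<Longrightarrow> (\<lambda>m. log (1 / \<tau> m) (x m i)) \<longlonglongrightarrow> y i"
    unfolding trop_def by blast
  show "y \<in> T d k"
    unfolding T_def
  proof (intro CollectI conjI allI impI y)
    fix \<Lambda> \<mu> assume \<Lambda>: "\<forall>i\<in>{1..k}. \<Lambda> i \<in> even_partitions d" and \<mu>: "\<mu> \<in> even_partitions d"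
      and dom: "fusion k \<Lambda> \<succeq> fusion k (\<lambda>_. \<mu>)"
    have "real k * log (1 / \<tau> m) (x m \<mu>) \<le> (\<Sum>i\<in>{1..k}. log (1 / \<tau> m) (x m (\<Lambda> i)))" for m
    proof -
      have "k * ln (x m \<mu>) \<le> (\<Sum>i\<in>{1..k}. ln (x m (\<Lambda> i)))"
        using x \<Lambda> by (intro BP_dual_ln_le[OF assms x(1) _ _ \<mu> dom]) (auto simp: PiE_iff)
      moreover have "0 < ln (1 / \<tau> m)" using \<tau>[of m] by (simp add: ln_gt_zero_iff)
      ultimately show ?thesis
        unfolding log_def sum_divide_distrib[symmetric] times_divide_eq_right
        by (intro divide_right_mono) auto
    qed
    moreover have "(\<lambda>m. real k * log (1 / \<tau> m) (x m \<mu>)) \<longlonglongrightarrow> real k * y \<mu>"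
      by (intro tendsto_intros lim \<mu>)
    moreover have "(\<lambda>m. \<Sum>i\<in>{1..k}. log (1 / \<tau> m) (x m (\<Lambda> i))) \<longlonglongrightarrow> (\<Sum>i\<in>{1..k}. y (\<Lambda> i))"
      using \<Lambda> by (intro tendsto_sum lim) auto
    ultimately show "real k * y \<mu> \<le> (\<Sum>i\<in>{1..k}. y (\<Lambda> i))"
      by (intro LIMSEQ_le) auto
  qed
qed

section \<open>The sets \<open>T d k\<close>\<close>

text \<open>Appending \<mu> to a family adds the same amount to both sides of the order condition
  and of the conclusion, so the conditions for \<open>k\<close> are among those for
  \<open>Suc k\<close>.\<close>

lemma T_Suc_subset: "T d (Suc k) \<subseteq> T d k"
proof
  fix y assume y: "y \<in> T d (Suc k)"
  show "y \<in> T d k"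
    unfolding T_def
  proof (intro CollectI conjI allI impI)
    show "y \<in> even_partitions d \<rightarrow>\<^sub>E UNIV" using y by (simp add: T_def)
    fix \<Lambda> \<mu> assume \<Lambda>: "\<forall>i\<in>{1..k}. \<Lambda> i \<in> even_partitions d" and \<mu>: "\<mu> \<in> even_partitions d"
      and dom: "fusion k \<Lambda> \<succeq> fusion k (\<lambda>_. \<mu>)"
    define \<Lambda>' where "\<Lambda>' = \<Lambda>(Suc k := \<mu>)"
    have \<Lambda>': "\<forall>i\<in>{1..Suc k}. \<Lambda>' i \<in> even_partitions d" using \<Lambda> \<mu> by (auto simp: \<Lambda>'_def le_Suc_eq)
    have sum: "(\<Sum>i\<in>{1..Suc k}. g (\<Lambda>' i)) = (\<Sum>i\<in>{1..k}. g (\<Lambda> i)) + g \<mu>" for g :: "nat multiset \<Rightarrow> 'b::comm_monoid_add"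
    proof -
      have "(\<Sum>i\<in>{1..k}. g (\<Lambda>' i)) = (\<Sum>i\<in>{1..k}. g (\<Lambda> i))" by (intro sum.cong) (auto simp: \<Lambda>'_def)
      then show ?thesis by (simp add: \<Lambda>'_def)
    qed
    have "k * hinge s \<mu> \<le> (\<Sum>i\<in>{1..k}. hinge s (\<Lambda> i))" if "s \<le> 2 * d" for s
      using dom fusion_superdominates_iff[of k \<Lambda> d \<mu>] \<Lambda> \<mu> that by simp
    then have "fusion (Suc k) \<Lambda>' \<succeq> fusion (Suc k) (\<lambda>_. \<mu>)"
      using fusion_superdominates_iff[of "Suc k" \<Lambda>' d \<mu>] \<Lambda>' \<mu> by (simp only: sum) (simp add: add.commute)
    then have "real (Suc k) * y \<mu> \<le> (\<Sum>i\<in>{1..Suc k}. y (\<Lambda>' i))"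
      using y \<Lambda>' \<mu> unfolding T_def by blast
    then show "real k * y \<mu> \<le> (\<Sum>i\<in>{1..k}. y (\<Lambda> i))"
      unfolding sum by (simp add: algebra_simps)
  qed
qed

lemma T_antimono: "k \<le> l \<Longrightarrow> T d l \<subseteq> T d k"
  by (rule lift_Suc_antimono_le[of "T d"]) (rule T_Suc_subset)

section \<open>Separating \<open>T d 1\<close> from \<open>T d 2\<close>\<close>

lemma hinge_replicate_mset [simp]: "hinge s (replicate_mset n r) = n * (s - r)"
  by (simp add: hinge_def)

lemma T_1_neq_T_2:
  assumes "d \<ge> 3"
  shows "T d 1 \<noteq> T d 2"
proof -
  define e where "e = d - 3"
  have d: "d = e + 3" using assms by (simp add: e_def)
  define a where "a = replicate_mset (e + 3) (2::nat)"
  define b where "b = replicate_mset (e + 1) (2::nat) + {#4#}"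
  define c where "c = replicate_mset e (2::nat) + {#6#}"
  have abc: "a \<in> even_partitions d" "b \<in> even_partitions d" "c \<in> even_partitions d"
    by (auto simp: a_def b_def c_def d even_partitions_def partitions_def)
  \<comment> \<open>The indicator of the partitions superdominating \<open>b\<close>: transitivity
    gives all conditions with one partition, while averaging \<open>a\<close> and \<open>c\<close>
    breaks a condition with two.\<close>
  define y where "y = restrict (\<lambda>\<alpha>. if \<forall>s\<le>2*d. hinge s b \<le> hinge s \<alpha> then 1 else 0 :: real) (even_partitions d)"
  have "y \<in> T d 1"
    unfolding T_def
  proof (intro CollectI conjI allI impI)
    show "y \<in> even_partitions d \<rightarrow>\<^sub>E UNIV" by (simp add: y_def)
    fix \<Lambda> \<mu> assume \<Lambda>: "\<forall>i\<in>{1..1}. \<Lambda> i \<in> even_partitions d" and \<mu>: "\<mu> \<in> even_partitions d"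
      and dom: "fusion 1 \<Lambda> \<succeq> fusion 1 (\<lambda>_. \<mu>)"
    have "\<forall>s\<le>2*d. hinge s \<mu> \<le> hinge s (\<Lambda> 1)"
      using dom fusion_superdominates_iff[of 1 \<Lambda> d \<mu>] \<Lambda> \<mu> by simp
    then show "real 1 * y \<mu> \<le> (\<Sum>i\<in>{1..1}. y (\<Lambda> i))"
      using \<Lambda> \<mu> by (auto simp: y_def intro: order_trans)
  qed
  moreover have "y \<notin> T d 2"
  proof
    assume y: "y \<in> T d 2"
    define \<Lambda> where "\<Lambda> = (\<lambda>i::nat. if i = 1 then a else c)"
    have \<Lambda>: "\<forall>i\<in>{1..2}. \<Lambda> i \<in> even_partitions d" using abc by (simp add: \<Lambda>_def)
    have sum: "(\<Sum>i\<in>{1..2}. g (\<Lambda> i)) = g a + g c" for g :: "nat multiset \<Rightarrow> 'b::comm_monoid_add"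
      by (simp add: \<Lambda>_def numeral_2_eq_2)
    \<comment> \<open>After cancelling the common parts 2, this is convexity of the hinge at the
      points 2, 4, 6.\<close>
    have "2 * hinge s b \<le> hinge s a + hinge s c" for s
      by (simp add: a_def b_def c_def add_mult_distrib)
    then have "\<forall>s\<le>2 * d. 2 * hinge s b \<le> (\<Sum>i\<in>{1..2}. hinge s (\<Lambda> i))"
      unfolding sum by blast
    then have "fusion 2 \<Lambda> \<succeq> fusion 2 (\<lambda>_. b)"
      using \<Lambda> abc by (subst fusion_superdominates_iff) auto
    then have "real 2 * y b \<le> (\<Sum>i\<in>{1..2}. y (\<Lambda> i))"
      using y \<Lambda> abc unfolding T_def by blast
    then have "2 * y b \<le> y a + y c" unfolding sum by simp
    moreover have "y b = 1" "y a \<le> 1" using abc by (simp_all add: y_def)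
    \<comment> \<open>Only parts 2 count at threshold 4, and \<open>b\<close> has one more of them
      than \<open>c\<close>.\<close>
    moreover have "\<not> hinge 4 b \<le> hinge 4 c" by (simp add: b_def c_def)
    then have "\<not> (\<forall>s\<le>2*d. hinge s b \<le> hinge s c)" using assms by (auto intro!: exI[of _ 4])
    then have "y c = 0" using abc by (simp add: y_def)
    ultimately show False by simp
  qed
  ultimately show ?thesis by blast
qed


section \<open>From integral certificates to fusion inequalities\<close>

lemma ex_family_with_multiplicities:
  fixes w :: "'a \<Rightarrow> nat"
  assumes "finite A"
  shows "\<exists>\<Lambda>. (\<forall>i\<in>{1..sum w A}. \<Lambda> i \<in> A) \<and>
    (\<forall>g :: 'a \<Rightarrow> real. (\<Sum>i\<in>{1..sum w A}. g (\<Lambda> i)) = (\<Sum>a\<in>A. real (w a) * g a))"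
proof -
  have "\<exists>xs. set xs \<subseteq> A \<and> length xs = sum w A \<and>
    (\<forall>g :: 'a \<Rightarrow> real. (\<Sum>x\<leftarrow>xs. g x) = (\<Sum>a\<in>A. real (w a) * g a))"
    using assms
  proof (induction A)
    case (insert a A)
    then obtain xs where "set xs \<subseteq> A" "length xs = sum w A"
      "\<And>g :: 'a \<Rightarrow> real. (\<Sum>x\<leftarrow>xs. g x) = (\<Sum>a\<in>A. real (w a) * g a)" by auto
    then show ?case using insert.hyps
      by (intro exI[of _ "replicate (w a) a @ xs"]) (auto simp: sum_list_replicate)
  qed simp
  then obtain xs where xs: "set xs \<subseteq> A" "length xs = sum w A"
    "\<And>g :: 'a \<Rightarrow> real. (\<Sum>x\<leftarrow>xs. g x) = (\<Sum>a\<in>A. real (w a) * g a)" by auto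
  show ?thesis
  proof (intro exI[of _ "\<lambda>i. xs ! (i - 1)"] conjI ballI allI)
    fix i assume "i \<in> {1..sum w A}"
    then show "xs ! (i - 1) \<in> A" using xs(1,2) by (intro subsetD[OF xs(1)] nth_mem) auto
  next
    fix g :: "'a \<Rightarrow> real"
    have "(\<Sum>i\<in>{1..length xs}. g (xs ! (i - 1))) = (\<Sum>x\<leftarrow>xs. g x)"
      unfolding sum_list_sum_nth
      by (rule sum.reindex_bij_witness[of _ Suc "\<lambda>i. i - 1"]) auto
    then show "(\<Sum>i\<in>{1..sum w A}. g (xs ! (i - 1))) = (\<Sum>a\<in>A. real (w a) * g a)"
      unfolding xs(2,3) .
  qed
qed

text \<open>For fixed \<mu> the unknown \<open>u\<close> solves a linear system whose matrix is
  independent of \<open>z\<close>. Reading the multiplicities of a certificate as a family of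
  partitions turns its sign condition into one of the defining inequalities of some
  \<open>T d k\<close>.\<close>

lemma ex_tropical_power_sum_point:
  "\<exists>K. \<forall>z\<in>T d K. \<forall>\<mu>\<in>even_partitions d. \<exists>u. (\<forall>s<Suc (2 * d). 0 \<le> u s) \<and>
    (\<forall>\<alpha>\<in>even_partitions d.
      (\<Sum>s<Suc (2 * d). u s * (real (hinge s \<alpha>) - real (hinge s \<mu>))) \<le> z \<alpha> - z \<mu>)"
proof -
  define n where "n = Suc (2 * d)"
  define E where "E = even_partitions d"
  define I where "I = E <+> {..<n}"
  \<comment> \<open>Rows \<open>Inl \<alpha>\<close> hold the growth conditions, and rows
    \<open>Inr s\<close> the sign conditions \<open>- u s \<le> 0\<close>.\<close>
  define A where "A \<mu> i j = (case i of Inl \<alpha> \<Rightarrow> int (hinge j \<alpha>) - int (hinge j \<mu>)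
    | Inr s \<Rightarrow> if s = j then - 1 else 0)" for \<mu> and i :: "nat multiset + nat" and j
  \<comment> \<open>Sign rows contribute no partition, so only the \<open>Inl\<close> multiplicities
    determine the number of fused partitions.\<close>
  define size_of where "size_of w = (\<Sum>\<alpha>\<in>E. w (Inl \<alpha>))" for w :: "nat multiset + nat \<Rightarrow> nat"
  have finE: "finite E" unfolding E_def by (rule finite_even_partitions)
  have sumI: "(\<Sum>i\<in>I. g i) = (\<Sum>\<alpha>\<in>E. g (Inl \<alpha>)) + (\<Sum>s<n. g (Inr s))" for g :: "_ \<Rightarrow> 'b::comm_monoid_add"
    unfolding I_def using finE by (simp add: sum.Plus)
  have in_I [simp]: "Inl \<alpha> \<in> I \<longleftrightarrow> \<alpha> \<in> E" "Inr s \<in> I \<longleftrightarrow> s < n" for \<alpha> s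
    by (auto simp: I_def)
  have "finite I" using finE by (simp add: I_def)
  then have "\<forall>\<mu>. \<exists>W. finite W \<and> (\<forall>w\<in>W. \<forall>j<n. (\<Sum>i\<in>I. int (w i) * A \<mu> i j) = 0) \<and>
    (\<forall>\<beta> :: _ \<Rightarrow> real. (\<forall>w\<in>W. 0 \<le> (\<Sum>i\<in>I. real (w i) * \<beta> i)) \<longrightarrow>
      (\<exists>y. \<forall>i\<in>I. (\<Sum>j<n. of_int (A \<mu> i j) * y j) \<le> \<beta> i))"
    by (intro allI fourier_motzkin)
  from choice[OF this] obtain W where
    "\<forall>\<mu>. finite (W \<mu>) \<and> (\<forall>w\<in>W \<mu>. \<forall>j<n. (\<Sum>i\<in>I. int (w i) * A \<mu> i j) = 0) \<and>
    (\<forall>\<beta> :: _ \<Rightarrow> real. (\<forall>w\<in>W \<mu>. 0 \<le> (\<Sum>i\<in>I. real (w i) * \<beta> i)) \<longrightarrow>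
      (\<exists>y. \<forall>i\<in>I. (\<Sum>j<n. of_int (A \<mu> i j) * y j) \<le> \<beta> i))" ..
  then have W: "\<And>\<mu>. finite (W \<mu>)"
    "\<And>\<mu> w j. w \<in> W \<mu> \<Longrightarrow> j < n \<Longrightarrow> (\<Sum>i\<in>I. int (w i) * A \<mu> i j) = 0"
    "\<And>\<mu> \<beta>. (\<forall>w\<in>W \<mu>. 0 \<le> (\<Sum>i\<in>I. real (w i) * \<beta> i)) \<Longrightarrow>
      (\<exists>y. \<forall>i\<in>I. (\<Sum>j<n. of_int (A \<mu> i j) * y j) \<le> \<beta> i)"
    by blast+
  \<comment> \<open>Any common bound on the finitely many certificate sizes serves, because
    \<open>T d k\<close> decreases in \<open>k\<close>; the sum is one.\<close>
  define K where "K = (\<Sum>\<mu>\<in>E. \<Sum>w\<in>W \<mu>. size_of w)"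
  have K: "size_of w \<le> K" if "\<mu> \<in> E" "w \<in> W \<mu>" for \<mu> w
  proof -
    have "size_of w \<le> (\<Sum>w\<in>W \<mu>. size_of w)" using that W(1) by (intro member_le_sum) auto
    also have "\<dots> \<le> K" unfolding K_def using that finE by (intro member_le_sum) auto
    finally show ?thesis .
  qed
  have "\<exists>u. (\<forall>s<n. 0 \<le> u s) \<and>
    (\<forall>\<alpha>\<in>E. (\<Sum>s<n. u s * (real (hinge s \<alpha>) - real (hinge s \<mu>))) \<le> z \<alpha> - z \<mu>)"
    if z: "z \<in> T d K" and \<mu>: "\<mu> \<in> E" for z \<mu>
  proof -
    define \<beta> where "\<beta> = case_sum (\<lambda>\<alpha>. z \<alpha> - z \<mu>) (\<lambda>_::nat. 0)"
    have "0 \<le> (\<Sum>i\<in>I. real (w i) * \<beta> i)" if w: "w \<in> W \<mu>" for w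
    proof -
      define k where "k = size_of w"
      obtain \<Lambda> where \<Lambda>: "\<forall>i\<in>{1..k}. \<Lambda> i \<in> E"
        "\<And>g :: _ \<Rightarrow> real. (\<Sum>i\<in>{1..k}. g (\<Lambda> i)) = (\<Sum>\<alpha>\<in>E. real (w (Inl \<alpha>)) * g \<alpha>)"
        using ex_family_with_multiplicities[OF finE, of "\<lambda>\<alpha>. w (Inl \<alpha>)"]
        unfolding k_def size_of_def by blast
      have k: "(\<Sum>\<alpha>\<in>E. real (w (Inl \<alpha>)) * b) = k * b" for b :: real
        by (simp add: k_def size_of_def sum_distrib_right)
      have "k * hinge s \<mu> \<le> (\<Sum>i\<in>{1..k}. hinge s (\<Lambda> i))" if s: "s \<le> 2 * d" for s
      proof -
        have sn: "s < n" using s by (simp add: n_def)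
        \<comment> \<open>Column \<open>s\<close> of the combination vanishes and its sign rows
          contribute a nonpositive amount, so the partition rows give the hinge inequality at
          \<open>s\<close>.\<close>
        have "(\<Sum>s'<n. int (w (Inr s')) * A \<mu> (Inr s') s) = (\<Sum>s'<n. if s' = s then - int (w (Inr s')) else 0)"
          by (intro sum.cong) (auto simp: A_def)
        also have "\<dots> \<le> 0" using sn by simp
        finally have "0 \<le> (\<Sum>\<alpha>\<in>E. int (w (Inl \<alpha>)) * (int (hinge s \<alpha>) - int (hinge s \<mu>)))"
          using W(2)[OF w sn] unfolding sumI by (simp add: A_def)
        then have "0 \<le> real_of_int (\<Sum>\<alpha>\<in>E. int (w (Inl \<alpha>)) * (int (hinge s \<alpha>) - int (hinge s \<mu>)))"
          by (simp only: of_int_0_le_iff)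
        also have "\<dots> = (\<Sum>\<alpha>\<in>E. real (w (Inl \<alpha>)) * real (hinge s \<alpha>)) - (\<Sum>\<alpha>\<in>E. real (w (Inl \<alpha>)) * real (hinge s \<mu>))"
          by (simp add: right_diff_distrib sum_subtractf)
        also have "\<dots> = (\<Sum>i\<in>{1..k}. real (hinge s (\<Lambda> i))) - k * real (hinge s \<mu>)"
          unfolding \<Lambda>(2)[of "\<lambda>\<alpha>. real (hinge s \<alpha>)"] k ..
        finally have "real (k * hinge s \<mu>) \<le> real (\<Sum>i\<in>{1..k}. hinge s (\<Lambda> i))" by simp
        then show ?thesis by (simp only: of_nat_le_iff)
      qed
      then have "fusion k \<Lambda> \<succeq> fusion k (\<lambda>_. \<mu>)"
        using fusion_superdominates_iff[of k \<Lambda> d \<mu>] \<Lambda>(1) \<mu> by (simp add: E_def)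
      moreover have "z \<in> T d k" using z T_antimono[OF K[OF \<mu> w], of d] by (auto simp: k_def)
      ultimately have "k * z \<mu> \<le> (\<Sum>i\<in>{1..k}. z (\<Lambda> i))"
        using \<Lambda>(1) \<mu> unfolding T_def E_def by blast
      moreover have "(\<Sum>i\<in>I. real (w i) * \<beta> i) = (\<Sum>i\<in>{1..k}. z (\<Lambda> i)) - k * z \<mu>"
        unfolding sumI \<Lambda>(2)[of z] k[symmetric] by (simp add: \<beta>_def right_diff_distrib sum_subtractf)
      ultimately show ?thesis by simp
    qed
    then obtain u where u: "\<forall>i\<in>I. (\<Sum>j<n. of_int (A \<mu> i j) * u j) \<le> \<beta> i" using W(3) by blast
    have "0 \<le> u s" if s: "s < n" for s
    proof -
      have "(\<Sum>j<n. of_int (A \<mu> (Inr s) j) * u j) = (\<Sum>j<n. if s = j then - u j else 0)"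
        by (intro sum.cong) (auto simp: A_def)
      also have "\<dots> = - u s" using s by simp
      finally show ?thesis using u[rule_format, of "Inr s"] s by (simp add: \<beta>_def)
    qed
    moreover have "(\<Sum>s<n. u s * (real (hinge s \<alpha>) - real (hinge s \<mu>))) \<le> z \<alpha> - z \<mu>" if "\<alpha> \<in> E" for \<alpha>
      using u[rule_format, of "Inl \<alpha>"] that by (simp add: \<beta>_def A_def mult.commute)
    ultimately show ?thesis by blast
  qed
  then show ?thesis unfolding E_def n_def by blast
qed

section \<open>Points of the dual cone with prescribed growth\<close>

text \<open>The list \<open>1, t\<^sup>-\<^sup>u, \<dots>, t\<^sup>-\<^sup>u\<close> with about \<open>t\<^sup>u\<^sup>s\<close> copies of \<open>t\<^sup>-\<^sup>u\<close> has power sums of order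
  \<open>t powr (u * max 0 (s - r))\<close>; forming all products of entries multiplies power sums.\<close>

lemma ex_list_hinge_power_sum:
  fixes t u :: real
  assumes t: "1 \<le> t" and u: "0 \<le> u"
  shows "\<exists>L. \<forall>r\<ge>1. t powr (u * real (s - r)) / 2 \<le> (\<Sum>x\<leftarrow>L. x ^ r) \<and>
    (\<Sum>x\<leftarrow>L. x ^ r) \<le> 2 * t powr (u * real (s - r))"
proof (intro exI allI impI)
  \<comment> \<open>Rounding down costs at most a factor 2, since the rounded number is at least
    1.\<close>
  define N where "N = nat \<lfloor>t powr (u * s)\<rfloor>"
  have ge1: "1 \<le> t powr (u * s)" using t u by (intro ge_one_powr_ge_zero) auto
  then have "real N = of_int \<lfloor>t powr (u * s)\<rfloor>" unfolding N_def by simp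
  then have "real N \<le> t powr (u * s)" "t powr (u * s) < real N + 1"
    by (simp_all add: real_of_int_floor_add_one_gt)
  moreover from this ge1 have "1 \<le> real N" by (cases N) auto
  ultimately have N: "real N \<le> t powr (u * s)" "t powr (u * s) / 2 \<le> real N" by simp_all
  fix r :: nat assume r: "1 \<le> r"
  define p where "p = (\<Sum>x\<leftarrow>1 # replicate N (t powr (- u)). x ^ r)"
  have pw: "(t powr (- u)) ^ r = t powr (- u * r)"
    using t by (simp add: powr_realpow[symmetric] powr_powr)
  have p: "p = 1 + real N * t powr (- u * r)" by (simp add: p_def sum_list_replicate pw)
  have e: "t powr (u * s) * t powr (- u * r) = t powr (u * (real s - real r))"
    by (simp add: powr_add[symmetric] algebra_simps)
  have up: "p \<le> 1 + t powr (u * (real s - real r))"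
    unfolding p e[symmetric] using N(1) by (intro add_left_mono mult_right_mono) auto
  have "t powr (u * s) / 2 * t powr (- u * r) \<le> real N * t powr (- u * r)"
    using N(2) by (intro mult_right_mono) auto
  then have lo: "1 + t powr (u * (real s - real r)) / 2 \<le> p"
    unfolding p e[symmetric] by simp
  show "t powr (u * real (s - r)) / 2 \<le> p \<and> p \<le> 2 * t powr (u * real (s - r))"
  proof (cases "r \<le> s")
    case True
    then have "real (s - r) = real s - real r" by simp
    moreover have "1 \<le> t powr (u * real (s - r))" using t u by (intro ge_one_powr_ge_zero) auto
    ultimately show ?thesis using up lo by auto
  next
    \<comment> \<open>Beyond the threshold the entry 1 dominates: all the small entries together
      contribute at most 1.\<close>
    case False
    have "t powr (u * (real s - real r)) \<le> t powr 0"
      using t u False by (intro powr_mono) (auto simp: mult_le_0_iff)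
    moreover have "0 \<le> t powr (u * (real s - real r))" by simp
    ultimately show ?thesis using up lo False t by auto
  qed
qed

lemma sum_list_products:
  fixes xs ys :: "'a::comm_semiring_1 list"
  shows "(\<Sum>z\<leftarrow>concat (map (\<lambda>x. map (\<lambda>y. x * y) ys) xs). z ^ r) = (\<Sum>x\<leftarrow>xs. x ^ r) * (\<Sum>y\<leftarrow>ys. y ^ r)"
  by (induction xs) (simp_all add: o_def power_mult_distrib sum_list_const_mult distrib_right)

text \<open>Product lists add growth exponents, so the hinges are realized one at a time, each
  costing a factor 2 in the bounds.\<close>

lemma ex_list_power_sum:
  fixes t :: real and u :: "nat \<Rightarrow> real"
  assumes "1 \<le> t" "finite S" "\<And>s. s \<in> S \<Longrightarrow> 0 \<le> u s"
  shows "\<exists>L. \<forall>r\<ge>1. t powr (\<Sum>s\<in>S. u s * real (s - r)) / 2 ^ card S \<le> (\<Sum>x\<leftarrow>L. x ^ r) \<and>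
    (\<Sum>x\<leftarrow>L. x ^ r) \<le> 2 ^ card S * t powr (\<Sum>s\<in>S. u s * real (s - r))"
  using assms(2,3)
proof (induction S)
  case empty
  show ?case using assms(1) by (intro exI[of _ "[1]"]) simp
next
  case (insert s S)
  then obtain L where L: "\<And>r. 1 \<le> r \<Longrightarrow> t powr (\<Sum>s\<in>S. u s * real (s - r)) / 2 ^ card S \<le> (\<Sum>x\<leftarrow>L. x ^ r)"
    "\<And>r. 1 \<le> r \<Longrightarrow> (\<Sum>x\<leftarrow>L. x ^ r) \<le> 2 ^ card S * t powr (\<Sum>s\<in>S. u s * real (s - r))" by auto
  obtain M where M: "\<And>r. 1 \<le> r \<Longrightarrow> t powr (u s * real (s - r)) / 2 \<le> (\<Sum>x\<leftarrow>M. x ^ r)"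
    "\<And>r. 1 \<le> r \<Longrightarrow> (\<Sum>x\<leftarrow>M. x ^ r) \<le> 2 * t powr (u s * real (s - r))"
    using ex_list_hinge_power_sum[OF assms(1), of "u s" s] insert.prems by auto
  show ?case
  proof (intro exI allI impI)
    fix r :: nat assume r: "1 \<le> r"
    let ?a = "t powr (\<Sum>s\<in>S. u s * real (s - r))" and ?b = "t powr (u s * real (s - r))"
    have pos: "0 \<le> (\<Sum>x\<leftarrow>M. x ^ r)" using M(1)[OF r] by (rule order_trans[rotated]) simp
    have ins: "t powr (\<Sum>s\<in>insert s S. u s * real (s - r)) = ?b * ?a"
      using insert.hyps by (simp add: powr_add)
    have "(?b / 2) * (?a / 2 ^ card S) \<le> (\<Sum>x\<leftarrow>M. x ^ r) * (\<Sum>x\<leftarrow>L. x ^ r)"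
      using L(1)[OF r] M(1)[OF r] pos by (intro mult_mono) auto
    moreover have "(\<Sum>x\<leftarrow>M. x ^ r) * (\<Sum>x\<leftarrow>L. x ^ r) \<le> (2 * ?b) * (2 ^ card S * ?a)"
      using L(2)[OF r] M(2)[OF r] pos order_trans[OF _ L(1)[OF r], of 0] by (intro mult_mono) auto
    ultimately show "t powr (\<Sum>s\<in>insert s S. u s * real (s - r)) / 2 ^ card (insert s S)
        \<le> (\<Sum>x\<leftarrow>concat (map (\<lambda>x. map (\<lambda>y. x * y) L) M). x ^ r) \<and>
      (\<Sum>x\<leftarrow>concat (map (\<lambda>x. map (\<lambda>y. x * y) L) M). x ^ r)
        \<le> 2 ^ card (insert s S) * t powr (\<Sum>s\<in>insert s S. u s * real (s - r))"
      unfolding sum_list_products ins using insert.hyps by (simp add: ac_simps)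
  qed
qed


section \<open>Evaluations at lists as elements of the dual cone\<close>

lemma power_sum_list:
  assumes "1 \<le> r" "length L \<le> n"
  shows "power_sum n r (\<lambda>i. if i \<in> {1..length L} then L ! (i - 1) else 0) = (\<Sum>x\<leftarrow>L. x ^ r)"
proof -
  have "power_sum n r (\<lambda>i. if i \<in> {1..length L} then L ! (i - 1) else 0)
      = (\<Sum>i\<in>{1..length L}. (L ! (i - 1)) ^ r)"
    unfolding power_sum_def using assms by (intro sum.mono_neutral_cong_right) auto
  also have "\<dots> = (\<Sum>i\<in>{0..<length L}. (L ! i) ^ r)"
    by (rule sum.reindex_bij_witness[of _ Suc "\<lambda>i. i - 1"]) auto
  finally show ?thesis by (simp add: sum_list_sum_nth)
qed

text \<open>Membership in \<open>BP d\<close> speaks of at least \<open>2 * d\<close> variables;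
  padding with zeros reaches that number without changing power sums of positive exponent.\<close>

lemma BP_list_nonneg:
  assumes "c \<in> BP d"
  shows "0 \<le> (\<Sum>\<alpha>\<in>even_partitions d. c \<alpha> * (\<Prod>r\<in>#\<alpha>. \<Sum>x\<leftarrow>L. x ^ r))"
proof -
  define n where "n = max (length L) (2 * d)"
  define X where "X = (\<lambda>i. if i \<in> {1..length L} then L ! (i - 1) else 0)"
  have "power_sum_partition n \<alpha> X = (\<Prod>r\<in>#\<alpha>. \<Sum>x\<leftarrow>L. x ^ r)" if "\<alpha> \<in> even_partitions d" for \<alpha>
    unfolding power_sum_partition_def X_def
    using even_partitionsD(3)[OF that]
    by (intro arg_cong[of _ _ prod_mset] image_mset_cong power_sum_list) (auto simp: n_def Suc_le_eq)
  then have "(\<Sum>\<alpha>\<in>even_partitions d. c \<alpha> * power_sum_partition n \<alpha> X)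
      = (\<Sum>\<alpha>\<in>even_partitions d. c \<alpha> * (\<Prod>r\<in>#\<alpha>. \<Sum>x\<leftarrow>L. x ^ r))" by simp
  moreover have "0 \<le> (\<Sum>\<alpha>\<in>even_partitions d. c \<alpha> * power_sum_partition n \<alpha> X)"
    using assms by (simp add: BP_def n_def)
  ultimately show ?thesis by simp
qed

lemma prod_mset_hinge_bounds:
  fixes P u :: "nat \<Rightarrow> real" and C t :: real
  assumes "1 \<le> C" "1 \<le> t"
    and "\<And>r. r \<in># \<alpha> \<Longrightarrow> t powr (\<Sum>s\<in>S. u s * real (s - r)) / C \<le> P r"
    and "\<And>r. r \<in># \<alpha> \<Longrightarrow> P r \<le> C * t powr (\<Sum>s\<in>S. u s * real (s - r))"
  shows "t powr (\<Sum>s\<in>S. u s * real (hinge s \<alpha>)) / C ^ size \<alpha> \<le> (\<Prod>r\<in>#\<alpha>. P r) \<and>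
    (\<Prod>r\<in>#\<alpha>. P r) \<le> C ^ size \<alpha> * t powr (\<Sum>s\<in>S. u s * real (hinge s \<alpha>))"
  using assms(3,4)
proof (induction \<alpha>)
  case empty
  then show ?case using assms(2) by simp
next
  case (add r \<alpha>)
  let ?a = "t powr (\<Sum>s\<in>S. u s * real (hinge s \<alpha>))" and ?b = "t powr (\<Sum>s\<in>S. u s * real (s - r))"
  have eq: "t powr (\<Sum>s\<in>S. u s * real (hinge s (add_mset r \<alpha>))) = ?b * ?a"
    by (simp add: powr_add[symmetric] sum.distrib algebra_simps)
  have IH: "?a / C ^ size \<alpha> \<le> (\<Prod>r\<in>#\<alpha>. P r)" "(\<Prod>r\<in>#\<alpha>. P r) \<le> C ^ size \<alpha> * ?a"
    using add by auto
  have r: "?b / C \<le> P r" "P r \<le> C * ?b" using add.prems by auto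
  have "0 \<le> ?a / C ^ size \<alpha>" "0 \<le> ?b / C" using assms(1) by simp_all
  then have pos: "0 \<le> P r" "0 \<le> (\<Prod>r\<in>#\<alpha>. P r)" using IH(1) r(1) by linarith+
  have "(?b / C) * (?a / C ^ size \<alpha>) \<le> P r * (\<Prod>r\<in>#\<alpha>. P r)"
    using IH(1) r(1) pos assms(1) by (intro mult_mono) auto
  moreover have "P r * (\<Prod>r\<in>#\<alpha>. P r) \<le> (C * ?b) * (C ^ size \<alpha> * ?a)"
    using IH(2) r(2) pos assms(1) by (intro mult_mono) auto
  ultimately show ?case unfolding eq by (simp add: ac_simps)
qed

lemma size_even_partition_le:
  assumes "\<alpha> \<in> even_partitions d"
  shows "size \<alpha> \<le> 2 * d"
proof -
  have "size \<alpha> \<le> sum_mset \<alpha>" if "\<forall>r\<in>#\<alpha>. 0 < r" for \<alpha> :: "nat multiset"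
    using that by (induction \<alpha>) auto
  then show ?thesis using even_partitionsD(1,3)[OF assms] by metis
qed

text \<open>A partition of \<open>2 * d\<close> has at most \<open>2 * d\<close> parts, which makes
  the constant uniform in \<alpha> and \<open>t\<close>.\<close>

lemma ex_list_power_sum_partition:
  fixes t :: real and u :: "nat \<Rightarrow> real"
  assumes "1 \<le> t" "finite S" "\<And>s. s \<in> S \<Longrightarrow> 0 \<le> u s"
  shows "\<exists>L. \<forall>\<alpha>\<in>even_partitions d.
    t powr (\<Sum>s\<in>S. u s * real (hinge s \<alpha>)) / 2 ^ (card S * (2 * d)) \<le> (\<Prod>r\<in>#\<alpha>. \<Sum>x\<leftarrow>L. x ^ r) \<and>
    (\<Prod>r\<in>#\<alpha>. \<Sum>x\<leftarrow>L. x ^ r) \<le> 2 ^ (card S * (2 * d)) * t powr (\<Sum>s\<in>S. u s * real (hinge s \<alpha>))"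
proof -
  obtain L where L: "\<And>r. 1 \<le> r \<Longrightarrow> t powr (\<Sum>s\<in>S. u s * real (s - r)) / 2 ^ card S \<le> (\<Sum>x\<leftarrow>L. x ^ r)"
    "\<And>r. 1 \<le> r \<Longrightarrow> (\<Sum>x\<leftarrow>L. x ^ r) \<le> 2 ^ card S * t powr (\<Sum>s\<in>S. u s * real (s - r))"
    using ex_list_power_sum[of t S u, OF assms] by blast
  show ?thesis
  proof (intro exI[of _ L] ballI)
    fix \<alpha> assume \<alpha>: "\<alpha> \<in> even_partitions d"
    define y where "y = t powr (\<Sum>s\<in>S. u s * real (hinge s \<alpha>))"
    define p where "p = (\<Prod>r\<in>#\<alpha>. \<Sum>x\<leftarrow>L. x ^ r)"
    have b: "y / (2 ^ card S) ^ size \<alpha> \<le> p \<and> p \<le> (2 ^ card S) ^ size \<alpha> * y"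
      unfolding y_def p_def
      using L even_partitionsD(3)[OF \<alpha>] assms(1)
      by (intro prod_mset_hinge_bounds) (auto simp: Suc_le_eq)
    have le: "(2 ^ card S) ^ size \<alpha> \<le> (2 ^ (card S * (2 * d)) :: real)"
      unfolding power_mult[symmetric] using size_even_partition_le[OF \<alpha>]
      by (intro power_increasing) auto
    have "y / 2 ^ (card S * (2 * d)) \<le> y / (2 ^ card S) ^ size \<alpha>"
      by (rule divide_left_mono[OF le]) (simp_all add: y_def)
    moreover have "(2 ^ card S) ^ size \<alpha> * y \<le> 2 ^ (card S * (2 * d)) * y"
      by (rule mult_right_mono[OF le]) (simp add: y_def)
    ultimately show "y / 2 ^ (card S * (2 * d)) \<le> p \<and> p \<le> 2 ^ (card S * (2 * d)) * y"
      using b by linarith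
  qed
qed

text \<open>A constant factor shifts the logarithm by a multiple of \<open>1 / ln (t m)\<close>,
  which tends to 0.\<close>

lemma log_tendsto_if_bounds:
  fixes x t :: "nat \<Rightarrow> real"
  assumes t: "\<And>m. 1 < t m" "filterlim t at_top sequentially" and C: "0 < C" "0 < D"
    and bounds: "\<And>m. t m powr y / C \<le> x m" "\<And>m. x m \<le> D * t m powr y"
  shows "(\<lambda>m. log (t m) (x m)) \<longlonglongrightarrow> y"
proof (rule tendsto_sandwich)
  have lt: "0 < ln (t m)" for m using t(1)[of m] by simp
  have y: "log (t m) (t m powr y) = y" for m using t(1)[of m] by simp
  have xpos: "0 < x m" for m
    using C t(1)[of m] by (intro less_le_trans[OF _ bounds(1)[of m]]) simp
  show "\<forall>\<^sub>F m in sequentially. y - ln C / ln (t m) \<le> log (t m) (x m)"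
  proof (intro always_eventually allI)
    fix m
    have "log (t m) (t m powr y / C) \<le> log (t m) (x m)"
      using bounds(1)[of m] C xpos[of m] t(1)[of m] by (subst log_le_cancel_iff) auto
    moreover have "log (t m) (t m powr y / C) = y - ln C / ln (t m)"
      using C t(1)[of m] by (simp add: log_divide y) (simp add: log_def)
    ultimately show "y - ln C / ln (t m) \<le> log (t m) (x m)" by simp
  qed
  show "\<forall>\<^sub>F m in sequentially. log (t m) (x m) \<le> y + ln D / ln (t m)"
  proof (intro always_eventually allI)
    fix m
    have "log (t m) (x m) \<le> log (t m) (D * t m powr y)"
      using bounds(2)[of m] C xpos[of m] t(1)[of m] by (subst log_le_cancel_iff) auto
    moreover have "log (t m) (D * t m powr y) = y + ln D / ln (t m)"
      using C t(1)[of m] by (simp add: log_mult y) (simp add: log_def)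
    ultimately show "log (t m) (x m) \<le> y + ln D / ln (t m)" by simp
  qed
  have ln: "filterlim (\<lambda>m. ln (t m)) at_top sequentially"
    by (rule filterlim_compose[OF ln_at_top t(2)])
  have z: "(\<lambda>m. a / ln (t m)) \<longlonglongrightarrow> 0" for a
    by (rule real_tendsto_divide_at_top[OF tendsto_const ln])
  show "(\<lambda>m. y - ln C / ln (t m)) \<longlonglongrightarrow> y"
    using tendsto_diff[OF tendsto_const[of y] z] by simp
  show "(\<lambda>m. y + ln D / ln (t m)) \<longlonglongrightarrow> y"
    using tendsto_add[OF tendsto_const[of y] z] by simp
qed

lemma ex_T_subset_trop_BP_dual: "\<exists>K. T d K \<subseteq> trop (even_partitions d) (BP_dual d)"
proof -
  define n where "n = Suc (2 * d)"
  define E where "E = even_partitions d"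
  have finE: "finite E" unfolding E_def by (rule finite_even_partitions)
  define C :: real where "C = 2 ^ (n * (2 * d))"
  have C: "0 < C" by (simp add: C_def)
  obtain K where K: "\<forall>z\<in>T d K. \<forall>\<mu>\<in>E. \<exists>u. (\<forall>s<n. 0 \<le> u s) \<and>
      (\<forall>\<alpha>\<in>E. (\<Sum>s<n. u s * (real (hinge s \<alpha>) - real (hinge s \<mu>))) \<le> z \<alpha> - z \<mu>)"
    using ex_tropical_power_sum_point[of d] unfolding n_def E_def by blast
  have "z \<in> trop E (BP_dual d)" if z: "z \<in> T d K" for z
  proof -
    from K z have "\<forall>\<mu>\<in>E. \<exists>u. (\<forall>s<n. 0 \<le> u s) \<and>
      (\<forall>\<alpha>\<in>E. (\<Sum>s<n. u s * (real (hinge s \<alpha>) - real (hinge s \<mu>))) \<le> z \<alpha> - z \<mu>)" by blast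
    from bchoice[OF this] obtain u where u: "\<And>\<mu> s. \<mu> \<in> E \<Longrightarrow> s < n \<Longrightarrow> 0 \<le> u \<mu> s"
      "\<And>\<mu> \<alpha>. \<mu> \<in> E \<Longrightarrow> \<alpha> \<in> E \<Longrightarrow>
        (\<Sum>s<n. u \<mu> s * (real (hinge s \<alpha>) - real (hinge s \<mu>))) \<le> z \<alpha> - z \<mu>" by blast
    \<comment> \<open>The growth exponent at \<alpha> of the list built for \<mu>. Shifted by
      \<open>z \<mu> - e \<mu> \<mu>\<close>, it agrees with \<open>z\<close> at \<mu> and lies
      below \<open>z\<close> elsewhere, so the maximum over \<mu> is \<open>z\<close>.\<close>
    define e where "e \<mu> \<alpha> = (\<Sum>s<n. u \<mu> s * real (hinge s \<alpha>))" for \<mu> \<alpha>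
    have e: "e \<mu> \<alpha> - e \<mu> \<mu> \<le> z \<alpha> - z \<mu>" if "\<mu> \<in> E" "\<alpha> \<in> E" for \<mu> \<alpha>
      using u(2)[OF that] by (simp add: e_def right_diff_distrib sum_subtractf)
    define t where "t m = 2 + real m" for m
    have t1: "1 < t m" for m by (simp add: t_def)
    define p where "p L \<alpha> = (\<Prod>r\<in>#\<alpha>. \<Sum>x\<leftarrow>L. x ^ r)" for L :: "real list" and \<alpha>
    have "\<exists>L. \<forall>\<alpha>\<in>E. t m powr e \<mu> \<alpha> / C \<le> p L \<alpha> \<and> p L \<alpha> \<le> C * t m powr e \<mu> \<alpha>" if "\<mu> \<in> E" for m \<mu>
      using ex_list_power_sum_partition[of "t m" "{..<n}" "u \<mu>" d] t1[of m] u(1)[OF that]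
      unfolding C_def e_def E_def p_def by auto
    then have "\<forall>m. \<forall>\<mu>\<in>E. \<exists>L. \<forall>\<alpha>\<in>E. t m powr e \<mu> \<alpha> / C \<le> p L \<alpha> \<and> p L \<alpha> \<le> C * t m powr e \<mu> \<alpha>"
      by blast
    then have "\<forall>m. \<exists>L. \<forall>\<mu>\<in>E. \<forall>\<alpha>\<in>E. t m powr e \<mu> \<alpha> / C \<le> p (L \<mu>) \<alpha> \<and> p (L \<mu>) \<alpha> \<le> C * t m powr e \<mu> \<alpha>"
    proof (intro allI)
      fix m
      from \<open>\<forall>m. \<forall>\<mu>\<in>E. \<exists>L. \<forall>\<alpha>\<in>E. t m powr e \<mu> \<alpha> / C \<le> p L \<alpha> \<and> p L \<alpha> \<le> C * t m powr e \<mu> \<alpha>\<close>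
      have "\<forall>\<mu>\<in>E. \<exists>L. \<forall>\<alpha>\<in>E. t m powr e \<mu> \<alpha> / C \<le> p L \<alpha> \<and> p L \<alpha> \<le> C * t m powr e \<mu> \<alpha>" by blast
      from bchoice[OF this]
      show "\<exists>L. \<forall>\<mu>\<in>E. \<forall>\<alpha>\<in>E. t m powr e \<mu> \<alpha> / C \<le> p (L \<mu>) \<alpha> \<and> p (L \<mu>) \<alpha> \<le> C * t m powr e \<mu> \<alpha>" .
    qed
    from choice[OF this] obtain L where L:
      "\<And>m \<mu> \<alpha>. \<mu> \<in> E \<Longrightarrow> \<alpha> \<in> E \<Longrightarrow> t m powr e \<mu> \<alpha> / C \<le> p (L m \<mu>) \<alpha>"
      "\<And>m \<mu> \<alpha>. \<mu> \<in> E \<Longrightarrow> \<alpha> \<in> E \<Longrightarrow> p (L m \<mu>) \<alpha> \<le> C * t m powr e \<mu> \<alpha>" by blast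
    \<comment> \<open>A sum of evaluations with positive weights stays in the dual cone, and its
      growth exponent is the maximum of those of its summands.\<close>
    define x where "x m = restrict (\<lambda>\<alpha>. \<Sum>\<mu>\<in>E. t m powr (z \<mu> - e \<mu> \<mu>) * p (L m \<mu>) \<alpha>) E" for m
    have ppos: "0 \<le> p (L m \<mu>) \<alpha>" if "\<mu> \<in> E" "\<alpha> \<in> E" for m \<mu> \<alpha>
      using C by (intro order_trans[OF _ L(1)[OF that]]) simp
    have lower: "t m powr z \<alpha> / C \<le> x m \<alpha>" if "\<alpha> \<in> E" for m \<alpha>
    proof -
      have "t m powr z \<alpha> / C = t m powr (z \<alpha> - e \<alpha> \<alpha>) * (t m powr e \<alpha> \<alpha> / C)"
        by (simp add: powr_add[symmetric])
      also have "\<dots> \<le> t m powr (z \<alpha> - e \<alpha> \<alpha>) * p (L m \<alpha>) \<alpha>"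
        by (intro mult_left_mono L that) simp
      also have "\<dots> \<le> (\<Sum>\<mu>\<in>E. t m powr (z \<mu> - e \<mu> \<mu>) * p (L m \<mu>) \<alpha>)"
        using finE that ppos by (intro member_le_sum[of \<alpha> E "\<lambda>\<mu>. t m powr (z \<mu> - e \<mu> \<mu>) * p (L m \<mu>) \<alpha>"]) auto
      finally show ?thesis using that by (simp add: x_def)
    qed
    have upper: "x m \<alpha> \<le> (C * card E) * t m powr z \<alpha>" if "\<alpha> \<in> E" for m \<alpha>
    proof -
      have "t m powr (z \<mu> - e \<mu> \<mu>) * p (L m \<mu>) \<alpha> \<le> C * t m powr z \<alpha>" if \<mu>: "\<mu> \<in> E" for \<mu>
      proof -
        have "t m powr (z \<mu> - e \<mu> \<mu>) * p (L m \<mu>) \<alpha> \<le> t m powr (z \<mu> - e \<mu> \<mu>) * (C * t m powr e \<mu> \<alpha>)"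
          by (intro mult_left_mono L \<mu> \<open>\<alpha> \<in> E\<close>) simp
        also have "\<dots> = C * t m powr (z \<mu> - e \<mu> \<mu> + e \<mu> \<alpha>)" by (simp add: powr_add)
        also have "\<dots> \<le> C * t m powr z \<alpha>"
          using e[OF \<mu> \<open>\<alpha> \<in> E\<close>] C t1[of m] by (intro mult_left_mono powr_mono) auto
        finally show ?thesis .
      qed
      then have "(\<Sum>\<mu>\<in>E. t m powr (z \<mu> - e \<mu> \<mu>) * p (L m \<mu>) \<alpha>) \<le> (\<Sum>\<mu>\<in>E. C * t m powr z \<alpha>)"
        by (rule sum_mono)
      then show ?thesis using that by (simp add: x_def mult_ac)
    qed
    have xpos: "0 < x m \<alpha>" if "\<alpha> \<in> E" for m \<alpha>
      using C t1[of m] by (intro less_le_trans[OF _ lower[OF that]]) simp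
    have mem: "x m \<in> BP_dual d" for m
      unfolding BP_dual_def
    proof (intro CollectI conjI ballI)
      show "x m \<in> even_partitions d \<rightarrow>\<^sub>E UNIV" by (simp add: x_def E_def)
      fix c assume c: "c \<in> BP d"
      have "(\<Sum>\<alpha>\<in>E. c \<alpha> * x m \<alpha>) = (\<Sum>\<alpha>\<in>E. \<Sum>\<mu>\<in>E. t m powr (z \<mu> - e \<mu> \<mu>) * (c \<alpha> * p (L m \<mu>) \<alpha>))"
        by (intro sum.cong refl) (simp add: x_def sum_distrib_left mult_ac)
      also have "\<dots> = (\<Sum>\<mu>\<in>E. t m powr (z \<mu> - e \<mu> \<mu>) * (\<Sum>\<alpha>\<in>E. c \<alpha> * p (L m \<mu>) \<alpha>))"
        unfolding sum_distrib_left by (rule sum.swap)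
      also have "0 \<le> \<dots>"
        unfolding p_def E_def by (intro sum_nonneg mult_nonneg_nonneg BP_list_nonneg c) simp
      finally show "0 \<le> (\<Sum>\<alpha>\<in>even_partitions d. c \<alpha> * x m \<alpha>)" by (simp add: E_def)
    qed
    have tlim: "filterlim t at_top sequentially"
      unfolding t_def by (rule filterlim_tendsto_add_at_top[OF tendsto_const filterlim_real_sequentially])
    have "(\<lambda>m. log (1 / (1 / t m)) (x m \<alpha>)) \<longlonglongrightarrow> z \<alpha>" if \<alpha>: "\<alpha> \<in> E" for \<alpha>
    proof -
      have "0 < card E" using \<alpha> finE by (auto simp: card_gt_0_iff)
      then have "0 < C * card E" using C by simp
      from log_tendsto_if_bounds[where x = "\<lambda>m. x m \<alpha>", OF t1 tlim C this lower[OF \<alpha>] upper[OF \<alpha>]]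
      show ?thesis by simp
    qed
    moreover have "(\<lambda>m. 1 / t m) \<longlonglongrightarrow> 0"
      by (rule real_tendsto_divide_at_top[OF tendsto_const tlim])
    moreover have "1 / t m \<in> {0<..<1}" for m by (simp add: t_def)
    moreover have "x m \<in> BP_dual d \<inter> (E \<rightarrow>\<^sub>E {0<..})" for m
      using mem xpos by (simp add: PiE_iff) (simp add: x_def)
    moreover have "z \<in> E \<rightarrow>\<^sub>E UNIV" using z by (simp add: T_def E_def)
    ultimately show ?thesis
      unfolding trop_def by (intro CollectI conjI exI[of _ x] exI[of _ "\<lambda>m. 1 / t m"]) blast+
  qed
  then show ?thesis unfolding E_def by blast
qed

section \<open>The stabilization index\<close>

theorem theorem5p9:
  fixes d :: nat
  assumes "d \<ge> 3"
  shows "\<exists>\<tau>::nat. \<tau> \<ge> 2 \<and> (\<forall>k\<ge>\<tau>. T d k = T d \<tau>) \<and> T d \<tau> \<subset> T d (\<tau> - 1) \<and>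
           trop (even_partitions d) (BP_dual d) = T d \<tau>"
proof -
  define R where "R = trop (even_partitions d) (BP_dual d)"
  have sub: "R \<subseteq> T d k" if "1 \<le> k" for k
    unfolding R_def using assms that by (intro trop_BP_dual_subset_T) auto
  obtain K where K: "T d K \<subseteq> R" unfolding R_def using ex_T_subset_trop_BP_dual by blast
  define P where "P k \<longleftrightarrow> 1 \<le> k \<and> T d k = R" for k
  \<comment> \<open>The step to \<open>Suc K\<close> makes the index positive, as the inclusion of
    the tropicalization in \<open>T d k\<close> was shown for \<open>k \<ge> 1\<close>.\<close>
  have "P (Suc K)" using T_Suc_subset[of d K] K sub[of "Suc K"] by (auto simp: P_def)
  \<comment> \<open>Minimality yields the strict inclusion at the preceding index.\<close>
  define \<tau> where "\<tau> = (LEAST k. P k)"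
  have \<tau>: "1 \<le> \<tau>" "T d \<tau> = R"
    using LeastI[of P, OF \<open>P (Suc K)\<close>] by (simp_all add: \<tau>_def P_def)
  \<comment> \<open>If the tropicalization were \<open>T d 1\<close>, then \<open>T d 2\<close>,
    lying between the two, would coincide with \<open>T d 1\<close>.\<close>
  have "\<tau> \<noteq> 1" using \<tau>(2) T_1_neq_T_2[OF assms] T_antimono[of 1 2 d] sub[of 2] by auto
  then have "2 \<le> \<tau>" using \<tau>(1) by simp
  moreover have "T d k = T d \<tau>" if "\<tau> \<le> k" for k
    using T_antimono[OF that, of d] sub[of k] \<tau> that by auto
  moreover have "\<not> P (\<tau> - 1)" using \<tau>(1) not_less_Least[of "\<tau> - 1" P] by (simp add: \<tau>_def)
  then have "T d (\<tau> - 1) \<noteq> R" using \<open>2 \<le> \<tau>\<close> by (simp add: P_def)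
  then have "T d \<tau> \<subset> T d (\<tau> - 1)" using sub[of "\<tau> - 1"] \<tau> \<open>2 \<le> \<tau>\<close> by (simp add: psubset_eq)
  ultimately show ?thesis using \<tau>(2) unfolding R_def by blast
qed

end
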